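(* Let $k$ be a field with $\operatorname{char}(k)\neq 2$ and let $X=X_0\sqcup X_1$ be a well-ordered set. Then the set $\mathrm{Tab}_s(X)$ of all GDN supertableaux over $X$ is a linear basis of the free GDN superalgebra $\mathrm{GDN}_s(X)$. Moreover, the GDN superalgebra homomorphism $\varphi:(\mathrm{GDN}_s(X),\circ)\to(k_s\{X\},\circ)$ determined by $\varphi(a)=a$ for all $a\in X$ is injective, where $k_s\{X\}$ is the free associative differential supercommutative algebra on $X$ and $u\circ v:=u\cdot D(v)$.
   Context: A superalgebra over $k$ is a vector space $\mathcal A=\mathcal A_0\oplus\mathcal A_1$ with a bilinear product $\circ$ such that $\mathcal A_i\circ\mathcal A_j\subseteq\mathcal A_{i+j}$ (indices mod 2); for nonzero $x\in\mathcal A_i$ write $|x|=i$. A (left) GDN (Gelfand–Dorfman–Novikov) superalgebra is a superalgebra satisfying, for all homogeneous $x,y,z$: $x\circ(y\circ z)-(x\circ y)\circ z=(-1)^{|x||y|}\big(y\circ(x\circ z)-(y\circ x)\circ z\big)$ (left supersymmetry) and $(x\circ y)\circ z=(-1)^{|y||z|}(x\circ z)\circ y$ (right supercommutativity). $X=X_0\sqcup X_1$ is a well-ordered set whose elements of $X_i$ have parity $i$; $\mathrm{GDN}_s(X)$ denotes the free GDN superalgebra over $k$ generated by $X$ (with $X_i$ of parity $i$). Terms over $X$: every $a\in X$ is a term, and if $\mu,\nu$ are terms then $(\mu\circ\nu)$ is a term; terms are regarded as elements of $\mathrm{GDN}_s(X)$. Write $[\mu_1,\dots,\mu_n]_L=((\cdots((\mu_1\circ\mu_2)\circ\mu_3)\cdots)\circ\mu_n)$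 and $[\mu_1,\dots,\mu_n]_R=(\mu_1\circ(\cdots\circ(\mu_{n-1}\circ\mu_n)\cdots))$. A simple term is $[a_1,\dots,a_n]_R$ with $a_i\in X$, $n\ge1$ (for $n=1$ it is the letter $a_1$). A GDN supertableau over $X$ is a term $\mu=[a,\mu_1,\dots,\mu_n]_L$ with $a\in X$, $n\ge0$, and simple terms $\mu_i=[a_{i,r_i},\dots,a_{i,1}]_R$ of length $r_i\ge1$, such that: (i) $r_1\ge r_2\ge\dots\ge r_n$; (ii) if $r_i=r_{i+1}$ then $a_{i,1}\ge a_{i+1,1}$; (iii) $a\ge a_{1,r_1}\ge\dots\ge a_{1,2}\ge a_{2,r_2}\ge\dots\ge a_{2,2}\ge\dots\ge a_{n,r_n}\ge\dots\ge a_{n,2}$; (iv) among the letters in the chain of (iii) (i.e. $a$ and all $a_{i,j}$ with $j\ge2$), any two occupying different positions and both lying in $X_1$ are distinct; (v) if $a_{i,1},a_{i+1,1}\in X_1$ and $r_i=r_{i+1}$ then $a_{i,1}\neq a_{i+1,1}$. $\mathrm{Tab}_s(X)$ is the set of all GDN supertableaux over $X$. An associative differential supercommutative algebra is an associative superalgebra $(\mathcal A,\cdot)$ (not necessarily unital) with $x\cdot y=(-1)^{|x||y|}y\cdot x$ for homogeneous $x,y$, together with a linear map $D$ preserving parity and satisfying $D(x\cdot y)=D(x)\cdot y+x\cdot D(y)$. $k_s\{X\}$ is the free such algebra on $X$ (with $X_i$ of parity $i$). *)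

theory Defs
  imports Main
begin

text \<open>The parity of letters is given by a predicate par :: 'x => bool
  (par a = True iff a is in X_1).  Parities live in Z/2, encoded as bool with xor.\<close>

datatype 'x gterm = GV 'x | GO "'x gterm" "'x gterm"

datatype 'x dterm = DV 'x | DM "'x dterm" "'x dterm" | DD "'x dterm"

fun gpar :: "('x \<Rightarrow> bool) \<Rightarrow> 'x gterm \<Rightarrow> bool" where
  "gpar p (GV a) = p a"
| "gpar p (GO u v) = (gpar p u \<noteq> gpar p v)"

fun dpar :: "('x \<Rightarrow> bool) \<Rightarrow> 'x dterm \<Rightarrow> bool" where
  "dpar p (DV a) = p a"
| "dpar p (DM u v) = (dpar p u \<noteq> dpar p v)"
| "dpar p (DD u) = dpar p u"

definition psign :: "bool \<Rightarrow> bool \<Rightarrow> 'k::comm_ring_1" where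
  "psign a b = (if a \<and> b then -1 else 1)"

(* linear combinations of terms: functions with finite support *)
definition fin_supp :: "('t \<Rightarrow> 'k::zero) \<Rightarrow> bool" where
  "fin_supp f \<longleftrightarrow> finite {t. f t \<noteq> 0}"

definition lc_single :: "'t \<Rightarrow> 't \<Rightarrow> 'k::zero_neq_one" where
  "lc_single s = (\<lambda>t. if t = s then 1 else 0)"

definition lin :: "('s \<Rightarrow> 't \<Rightarrow> 'k::comm_ring_1) \<Rightarrow> ('s \<Rightarrow> 'k) \<Rightarrow> 't \<Rightarrow> 'k" where
  "lin h f = (\<lambda>u. \<Sum>s\<in>{s. f s \<noteq> 0}. f s * h s u)"

section \<open>Free GDN superalgebra: the free nonassociative superalgebra modulo the
  ideal generated by the GDN identities\<close>

inductive_set GDN_ideal :: "('x \<Rightarrow> bool) \<Rightarrow> ('x gterm \<Rightarrow> 'k::field) set"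
  for p :: "'x \<Rightarrow> bool" where
  lsym: "(\<lambda>t. lc_single (GO x (GO y z)) t - lc_single (GO (GO x y) z) t
           - psign (gpar p x) (gpar p y) *
             (lc_single (GO y (GO x z)) t - lc_single (GO (GO y x) z) t)) \<in> GDN_ideal p"
| rcom: "(\<lambda>t. lc_single (GO (GO x y) z) t
           - psign (gpar p y) (gpar p z) * lc_single (GO (GO x z) y) t) \<in> GDN_ideal p"
| zero: "(\<lambda>t. 0) \<in> GDN_ideal p"
| add: "f \<in> GDN_ideal p \<Longrightarrow> g \<in> GDN_ideal p \<Longrightarrow> (\<lambda>t. f t + g t) \<in> GDN_ideal p"
| smult: "f \<in> GDN_ideal p \<Longrightarrow> (\<lambda>t. c * f t) \<in> GDN_ideal p"
| lmul: "f \<in> GDN_ideal p \<Longrightarrow> lin (\<lambda>s. lc_single (GO u s)) f \<in> GDN_ideal p"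
| rmul: "f \<in> GDN_ideal p \<Longrightarrow> lin (\<lambda>s. lc_single (GO s u)) f \<in> GDN_ideal p"

section \<open>Free associative differential supercommutative algebra k_s{X}:
  free differential nonassociative algebra modulo the differential ideal generated
  by associativity, supercommutativity and the Leibniz rule\<close>

inductive_set DS_ideal :: "('x \<Rightarrow> bool) \<Rightarrow> ('x dterm \<Rightarrow> 'k::field) set"
  for p :: "'x \<Rightarrow> bool" where
  assoc: "(\<lambda>t. lc_single (DM (DM x y) z) t - lc_single (DM x (DM y z)) t) \<in> DS_ideal p"
| scomm: "(\<lambda>t. lc_single (DM x y) t
           - psign (dpar p x) (dpar p y) * lc_single (DM y x) t) \<in> DS_ideal p"
| leib: "(\<lambda>t. lc_single (DD (DM x y)) t - lc_single (DM (DD x) y) t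
           - lc_single (DM x (DD y)) t) \<in> DS_ideal p"
| zero: "(\<lambda>t. 0) \<in> DS_ideal p"
| add: "f \<in> DS_ideal p \<Longrightarrow> g \<in> DS_ideal p \<Longrightarrow> (\<lambda>t. f t + g t) \<in> DS_ideal p"
| smult: "f \<in> DS_ideal p \<Longrightarrow> (\<lambda>t. c * f t) \<in> DS_ideal p"
| lmul: "f \<in> DS_ideal p \<Longrightarrow> lin (\<lambda>s. lc_single (DM u s)) f \<in> DS_ideal p"
| rmul: "f \<in> DS_ideal p \<Longrightarrow> lin (\<lambda>s. lc_single (DM s u)) f \<in> DS_ideal p"
| der: "f \<in> DS_ideal p \<Longrightarrow> lin (\<lambda>s. lc_single (DD s)) f \<in> DS_ideal p"

fun phi :: "'x gterm \<Rightarrow> 'x dterm" where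
  "phi (GV a) = DV a"
| "phi (GO u v) = DM (phi u) (DD (phi v))"

definition phi_lin :: "('x gterm \<Rightarrow> 'k::field) \<Rightarrow> 'x dterm \<Rightarrow> 'k" where
  "phi_lin f = lin (\<lambda>s. lc_single (phi s)) f"

fun rcomb :: "'x list \<Rightarrow> 'x gterm" where
  "rcomb [] = undefined"
| "rcomb [a] = GV a"
| "rcomb (a # b # as) = GO (GV a) (rcomb (b # as))"

fun lcomb :: "'x gterm \<Rightarrow> 'x gterm list \<Rightarrow> 'x gterm" where
  "lcomb t [] = t"
| "lcomb t (m # ms) = lcomb (GO t m) ms"

text \<open>A tableau is given by a letter a and rows ls, where ls ! i is the list
  [a_{i,r_i}, ..., a_{i,1}] (so last (ls ! i) = a_{i,1} and butlast (ls ! i)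
  = [a_{i,r_i}, ..., a_{i,2}]).\<close>

definition tab_chain :: "'x \<Rightarrow> 'x list list \<Rightarrow> 'x list" where
  "tab_chain a ls = a # concat (map butlast ls)"

definition is_tab :: "('x \<Rightarrow> bool) \<Rightarrow> 'x::linorder \<Rightarrow> 'x list list \<Rightarrow> bool" where
  "is_tab p a ls \<longleftrightarrow>
     (\<forall>l\<in>set ls. l \<noteq> [])
   \<and> (\<forall>i. Suc i < length ls \<longrightarrow> length (ls ! Suc i) \<le> length (ls ! i))
   \<and> (\<forall>i. Suc i < length ls \<longrightarrow> length (ls ! i) = length (ls ! Suc i)
          \<longrightarrow> last (ls ! Suc i) \<le> last (ls ! i))
   \<and> sorted_wrt (\<lambda>x y. y \<le> x) (tab_chain a ls)
   \<and> (\<forall>i j. i < j \<longrightarrow> j < length (tab_chain a ls)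
          \<longrightarrow> p (tab_chain a ls ! i) \<longrightarrow> p (tab_chain a ls ! j)
          \<longrightarrow> tab_chain a ls ! i \<noteq> tab_chain a ls ! j)
   \<and> (\<forall>i. Suc i < length ls \<longrightarrow> p (last (ls ! i)) \<longrightarrow> p (last (ls ! Suc i))
          \<longrightarrow> length (ls ! i) = length (ls ! Suc i)
          \<longrightarrow> last (ls ! i) \<noteq> last (ls ! Suc i))"

definition Tab :: "('x \<Rightarrow> bool) \<Rightarrow> 'x::linorder gterm set" where
  "Tab p = {lcomb (GV a) (map rcomb ls) | a ls. is_tab p a ls}"

end

theory Submission
  imports Defs "HOL-Library.Multiset" "HOL-Library.Function_Algebras" "HOL-Library.Product_Lexorder"
begin

text \<open>
  Filter by the number of rows. Ignoring signs and working modulo terms with more rows, left symmetry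
  says that the two letters \<open>a, b\<close> in \<open>a \<circ> (b \<circ> w)\<close> commute, and right commutativity permutes the rows;
  so a product of rows depends only on the multiset of letters in its chain and on the multiset of
  pairs of a last letter and a row length. Hence every term can be sorted into a tableau. Signs come
  back for free: in terms with distinct labels as letters, multiplying by the sign of the permutation
  of the odd labels turns the ordinary identities into the super ones.

  For independence, the leading monomial of the image of a tableau in the differential algebra has
  all chain letters underived and the last letter of each row derived as often as the row is long.
  It is the only monomial in that image with the least number of derived letters, and it determines
  the tableau. Its coefficient is read off by functionals on words that change sign like a
  supercommutative product; these vanish on the defining ideal.
\<close>

text \<open>Under \<open>phi\<close> the associator
  \<open>x \<circ> (y \<circ> z) - (x \<circ> y) \<circ> z\<close> becomes
  \<open>x y D(D z)\<close>, which is supersymmetric in \<open>x\<close> and \<open>y\<close>.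
  Exchanging \<open>a\<close> and \<open>b\<close> in \<open>a \<circ> (b \<circ> w)\<close>
  therefore costs only the terms \<open>(a \<circ> b) \<circ> w\<close> and
  \<open>(b \<circ> a) \<circ> w\<close>, with two rows instead of one. A row enters the image under
  a derivation, so each of its monomials has a derived letter: counting rows on one side matches
  counting derived letters on the other, and one filtration governs both spanning and independence.
  Rewriting keeps the number of letters, which exceeds the number of rows, so the descent ends. The
  factor 2 appears when two equal odd letters are exchanged. Both algebras are given only by ideals
  of relations, so there are no coefficients to compare in the differential algebra; functionals
  that vanish on the ideal take their place. Independence is shown for the images, and together with
  spanning this also yields injectivity.\<close>

section \<open>Linear combinations\<close>

text \<open>Higher-order unification leaves eta-expanded sums \<open>\<lambda>t. (f + g) t\<close> in goals; with these rules
  the simplifier would push the application inside.\<close>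

declare plus_fun_apply [simp del] zero_fun_apply [simp del] minus_apply [simp del] uminus_apply [simp del]

lemmas fun_apps = plus_fun_apply zero_fun_apply minus_apply uminus_apply

definition subsp :: "('t \<Rightarrow> 'k::field) set \<Rightarrow> bool" where
  "subsp S \<longleftrightarrow> 0 \<in> S \<and> (\<forall>f\<in>S. \<forall>g\<in>S. f + g \<in> S) \<and> (\<forall>c. \<forall>f\<in>S. (\<lambda>t. c * f t) \<in> S)"

lemma subsp_0: "subsp S \<Longrightarrow> 0 \<in> S"
  and subsp_add: "subsp S \<Longrightarrow> f \<in> S \<Longrightarrow> g \<in> S \<Longrightarrow> f + g \<in> S"
  and subsp_smult: "subsp S \<Longrightarrow> f \<in> S \<Longrightarrow> (\<lambda>t. c * f t) \<in> S"
  by (auto simp: subsp_def)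

lemma subsp_uminus:
  assumes "subsp S" "f \<in> S"
  shows "- f \<in> S"
proof -
  have "- f = (\<lambda>t. - 1 * f t)" by (simp add: fun_eq_iff fun_apps)
  then show ?thesis using subsp_smult[OF assms] by metis
qed

lemma subsp_diff: "subsp S \<Longrightarrow> f \<in> S \<Longrightarrow> g \<in> S \<Longrightarrow> f - g \<in> S"
  using subsp_add[of S f "- g"] subsp_uminus[of S g] by simp

lemma subsp_diff_trans: "subsp S \<Longrightarrow> f - g \<in> S \<Longrightarrow> g - h \<in> S \<Longrightarrow> f - h \<in> S"
  using subsp_add[of S "f - g" "g - h"] by simp

lemma subsp_diff_sym: "subsp S \<Longrightarrow> f - g \<in> S \<Longrightarrow> g - f \<in> S"
  using subsp_uminus[of S "f - g"] by simp

lemma subsp_smultD: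
  assumes "subsp S" "(\<lambda>t. c * f t) \<in> S" "c \<noteq> 0"
  shows "f \<in> S"
proof -
  have "f = (\<lambda>t. inverse c * (c * f t))" using assms(3) by (simp add: fun_eq_iff fun_apps)
  then show ?thesis using subsp_smult[OF assms(1,2)] by metis
qed

lemma subsp_sum:
  assumes "subsp S" "finite A" "\<And>s. s \<in> A \<Longrightarrow> h s \<in> S"
  shows "(\<lambda>t. \<Sum>s\<in>A. c s * h s t) \<in> S"
  using assms(2,3)
proof (induction A rule: finite_induct)
  case empty
  then show ?case using subsp_0[OF assms(1)] by (simp add: zero_fun_def)
next
  case (insert a A)
  then have "(\<lambda>t. c a * h a t) + (\<lambda>t. \<Sum>s\<in>A. c s * h s t) \<in> S"
    using assms(1) by (intro subsp_add subsp_smult) auto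
  then show ?case using insert by (simp add: plus_fun_def)
qed

section \<open>Finite supports and linear extension\<close>

lemma fin_supp_single [simp]: "fin_supp (lc_single s)"
  by (simp add: fin_supp_def lc_single_def)

lemma fin_supp_0 [simp]: "fin_supp 0"
  by (simp add: fin_supp_def fun_apps)

lemma fin_supp_add [simp]: "fin_supp f \<Longrightarrow> fin_supp g \<Longrightarrow> fin_supp (f + g :: _ \<Rightarrow> 'k::field)"
  unfolding fin_supp_def by (rule finite_subset[of _ "{t. f t \<noteq> 0} \<union> {t. g t \<noteq> 0}"]) (auto simp: fun_apps)

lemma fin_supp_diff [simp]: "fin_supp f \<Longrightarrow> fin_supp g \<Longrightarrow> fin_supp (f - g :: _ \<Rightarrow> 'k::field)"
  unfolding fin_supp_def by (rule finite_subset[of _ "{t. f t \<noteq> 0} \<union> {t. g t \<noteq> 0}"]) (auto simp: fun_apps)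

lemma fin_supp_smult [simp]: "fin_supp f \<Longrightarrow> fin_supp (\<lambda>t. c * f t :: 'k::field)"
  unfolding fin_supp_def by (rule finite_subset[of _ "{t. f t \<noteq> 0}"]) auto

lemma subsp_fin_supp: "subsp {f. fin_supp f}"
  by (simp add: subsp_def)

lemma lin_superset:
  assumes "finite A" "{s. f s \<noteq> 0} \<subseteq> A"
  shows "lin h f u = (\<Sum>s\<in>A. f s * h s u)"
  unfolding lin_def by (rule sum.mono_neutral_left) (use assms in auto)

lemma lin_mem:
  assumes "subsp S" "fin_supp f" "\<And>s. f s \<noteq> 0 \<Longrightarrow> h s \<in> S"
  shows "lin h f \<in> S"
  unfolding lin_def using assms by (intro subsp_sum) (auto simp: fin_supp_def)

lemma fin_supp_lin [simp]: "fin_supp f \<Longrightarrow> (\<And>s. fin_supp (h s)) \<Longrightarrow> fin_supp (lin h f :: _ \<Rightarrow> 'k::field)"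
  using lin_mem[OF subsp_fin_supp, of f h] by simp

lemma lin_single [simp]: "lin h (lc_single s) = h s"
  by (rule ext, subst lin_superset[of "{s}"]) (auto simp: lc_single_def)

lemma lin_0 [simp]: "lin h 0 = 0"
  by (simp add: lin_def fun_eq_iff fun_apps)

text \<open>\<open>lin\<close> sums over the support, and a sum over an infinite set is 0 by
  convention. Two functions with infinite support whose sum has a single nonzero entry would break
  additivity, hence the support conditions.\<close>

lemma lin_add [simp]:
  assumes "fin_supp f" "fin_supp (g :: _ \<Rightarrow> 'k::field)"
  shows "lin h (f + g) = lin h f + lin h g"
proof
  fix u
  let ?A = "{s. f s \<noteq> 0} \<union> {s. g s \<noteq> 0}"
  have fin: "finite ?A" using assms by (simp add: fin_supp_def)
  show "lin h (f + g) u = (lin h f + lin h g) u"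
    using fin by (subst plus_fun_apply, (subst lin_superset[OF fin], force simp: fun_apps)+)
      (simp add: fun_apps sum.distrib distrib_right)
qed

lemma lin_smult [simp]:
  assumes "fin_supp (f :: _ \<Rightarrow> 'k::field)"
  shows "lin h (\<lambda>t. c * f t) = (\<lambda>u. c * lin h f u)"
proof
  fix u
  have fin: "finite {s. f s \<noteq> 0}" using assms by (simp add: fin_supp_def)
  show "lin h (\<lambda>t. c * f t) u = c * lin h f u"
    by ((subst lin_superset[OF fin], force simp: fun_apps)+) (simp add: sum_distrib_left mult.assoc)
qed

lemma lin_uminus [simp]: "fin_supp (f :: _ \<Rightarrow> 'k::field) \<Longrightarrow> lin h (- f) = - lin h f"
  using lin_smult[of f h "- 1"] by (simp add: fun_Compl_def)

lemma lin_diff [simp]: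
  assumes "fin_supp f" "fin_supp (g :: _ \<Rightarrow> 'k::field)"
  shows "lin h (f - g) = lin h f - lin h g"
proof -
  have "fin_supp (- g)" using assms(2) by (simp add: fin_supp_def fun_apps)
  then show ?thesis using lin_add[OF assms(1), of "- g" h] assms(2) by simp
qed

lemma lin_lin:
  assumes "fin_supp (f :: _ \<Rightarrow> 'k::field)" "\<And>s. fin_supp (k s)"
  shows "lin h (lin k f) = lin (\<lambda>s. lin h (k s)) f"
proof
  fix u
  let ?F = "{s. f s \<noteq> 0}"
  let ?A = "\<Union>s\<in>?F. {t. k s t \<noteq> 0}"
  have F: "finite ?F" using assms(1) by (simp add: fin_supp_def)
  have A: "finite ?A" using assms F by (simp add: fin_supp_def)
  have sub: "{t. lin k f t \<noteq> 0} \<subseteq> ?A"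
    by (auto simp: lin_def elim!: sum.not_neutral_contains_not_neutral)
  have "lin h (lin k f) u = (\<Sum>t\<in>?A. \<Sum>s\<in>?F. f s * (k s t * h t u))"
    by (subst lin_superset[OF A sub]) (simp add: lin_def sum_distrib_right mult.assoc)
  also have "\<dots> = (\<Sum>s\<in>?F. f s * (\<Sum>t\<in>?A. k s t * h t u))"
    by (subst sum.swap) (simp add: sum_distrib_left)
  also have "\<dots> = (\<Sum>s\<in>?F. f s * lin h (k s) u)"
    by (intro sum.cong refl arg_cong2[where f="(*)"], rule lin_superset[OF A, symmetric]) auto
  finally show "lin h (lin k f) u = lin (\<lambda>s. lin h (k s)) f u" by (simp add: lin_def)
qed

lemma lin_id:
  assumes "fin_supp (f :: _ \<Rightarrow> 'k::field)"
  shows "lin lc_single f = f"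
proof
  fix u
  have "finite (insert u {s. f s \<noteq> 0})" using assms by (simp add: fin_supp_def)
  then show "lin lc_single f u = f u"
    by (subst lin_superset[of "insert u {s. f s \<noteq> 0}"]) 
      (auto simp: lc_single_def if_distrib[of "\<lambda>x. _ * x"] cong: if_cong)
qed

section \<open>The two ideals\<close>

lemma subsp_GDN_ideal: "subsp (GDN_ideal p)"
  unfolding subsp_def
  by (auto simp: zero_fun_def plus_fun_def intro: GDN_ideal.zero GDN_ideal.add GDN_ideal.smult)

lemma subsp_DS_ideal: "subsp (DS_ideal p)"
  unfolding subsp_def
  by (auto simp: zero_fun_def plus_fun_def intro: DS_ideal.zero DS_ideal.add DS_ideal.smult)

lemma GDN_lsym:
  "(lc_single (GO x (GO y z)) - lc_single (GO (GO x y) z))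
    - (\<lambda>t. psign (gpar p x) (gpar p y) * (lc_single (GO y (GO x z)) - lc_single (GO (GO y x) z)) t)
   \<in> GDN_ideal p"
  using GDN_ideal.lsym[of x y z p] by (simp add: fun_diff_def)

lemma GDN_rcom:
  "lc_single (GO (GO x y) z) - (\<lambda>t. psign (gpar p y) (gpar p z) * lc_single (GO (GO x z) y) t)
   \<in> GDN_ideal p"
  using GDN_ideal.rcom[of x y z p] by (simp add: fun_diff_def)

lemma DS_assoc: "lc_single (DM (DM x y) z) - lc_single (DM x (DM y z)) \<in> DS_ideal p"
  using DS_ideal.assoc[of x y z p] by (simp add: fun_diff_def)

lemma DS_scomm:
  "lc_single (DM x y) - (\<lambda>t. psign (dpar p x) (dpar p y) * lc_single (DM y x) t) \<in> DS_ideal p"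
  using DS_ideal.scomm[of x y p] by (simp add: fun_diff_def)

lemma DS_leib: "lc_single (DD (DM x y)) - lc_single (DM (DD x) y) - lc_single (DM x (DD y)) \<in> DS_ideal p"
  using DS_ideal.leib[of x y p] by (simp add: fun_diff_def)

lemma GDN_ideal_fin_supp: "f \<in> GDN_ideal p \<Longrightarrow> fin_supp f"
proof (induction rule: GDN_ideal.induct)
  case (lsym x y z)
  show ?case
    by (intro subsp_diff[OF subsp_fin_supp, simplified fun_diff_def mem_Collect_eq] fin_supp_smult) auto
next
  case (rcom x y z)
  show ?case by (intro subsp_diff[OF subsp_fin_supp, simplified fun_diff_def mem_Collect_eq]) auto
next
  case (add f g)
  then show ?case using fin_supp_add[of f g] by (simp add: plus_fun_def)
qed (auto simp flip: zero_fun_def)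

lemma DS_ideal_fin_supp: "f \<in> DS_ideal p \<Longrightarrow> fin_supp f"
proof (induction rule: DS_ideal.induct)
  case (assoc x y z)
  show ?case by (intro subsp_diff[OF subsp_fin_supp, simplified fun_diff_def mem_Collect_eq]) auto
next
  case (scomm x y)
  show ?case by (intro subsp_diff[OF subsp_fin_supp, simplified fun_diff_def mem_Collect_eq]) auto
next
  case (leib x y)
  show ?case by (intro subsp_diff[OF subsp_fin_supp, simplified fun_diff_def mem_Collect_eq]) auto
next
  case (add f g)
  then show ?case using fin_supp_add[of f g] by (simp add: plus_fun_def)
qed (auto simp flip: zero_fun_def)

text \<open>The ideal is part of the span, so membership means being a combination of
  \<open>B\<close> modulo the identities. The inductive form lets a linear map be checked on
  \<open>B\<close> and on the ideal only.\<close>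

inductive_set tspan :: "('x \<Rightarrow> bool) \<Rightarrow> 'x gterm set \<Rightarrow> ('x gterm \<Rightarrow> 'k::field) set"
  for p B where
  gen: "b \<in> B \<Longrightarrow> lc_single b \<in> tspan p B"
| ideal: "f \<in> GDN_ideal p \<Longrightarrow> f \<in> tspan p B"
| add: "f \<in> tspan p B \<Longrightarrow> g \<in> tspan p B \<Longrightarrow> f + g \<in> tspan p B"
| smult: "f \<in> tspan p B \<Longrightarrow> (\<lambda>t. c * f t) \<in> tspan p B"

lemma tspan_add: "f \<in> tspan p B \<Longrightarrow> g \<in> tspan p B \<Longrightarrow> f + g \<in> tspan p B"
  using tspan.add[of f p B g] by (simp add: plus_fun_def)

lemma tspan_induct [consumes 1, case_names gen ideal add smult]:
  assumes "f \<in> tspan p B"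
    and "\<And>b. b \<in> B \<Longrightarrow> P (lc_single b)"
    and "\<And>f. f \<in> GDN_ideal p \<Longrightarrow> P f"
    and "\<And>f g. f \<in> tspan p B \<Longrightarrow> P f \<Longrightarrow> g \<in> tspan p B \<Longrightarrow> P g \<Longrightarrow> P (f + g)"
    and "\<And>f c. f \<in> tspan p B \<Longrightarrow> P f \<Longrightarrow> P (\<lambda>t. c * f t)"
  shows "P f"
  using assms(1) by (induction rule: tspan.induct) (use assms(2-) in \<open>auto simp: plus_fun_def\<close>)

lemma subsp_tspan: "subsp (tspan p B)"
  unfolding subsp_def using tspan.ideal[OF subsp_0[OF subsp_GDN_ideal]]
  by (auto intro: tspan_add tspan.smult)

lemma tspan_fin_supp: "f \<in> tspan p B \<Longrightarrow> fin_supp f"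
  by (induction rule: tspan_induct) (auto intro: GDN_ideal_fin_supp)

lemma tspan_lin:
  assumes "f \<in> tspan p B" "subsp S" "\<And>f. f \<in> GDN_ideal p \<Longrightarrow> lin h f \<in> S" "\<And>b. b \<in> B \<Longrightarrow> h b \<in> S"
  shows "lin h f \<in> S"
  using assms(1)
  by (induction rule: tspan_induct)
    (simp_all add: assms tspan_fin_supp subsp_add subsp_smult)

lemma tspan_subset:
  fixes f :: "'x gterm \<Rightarrow> 'k::field"
  assumes "\<And>b. b \<in> B \<Longrightarrow> (lc_single b :: 'x gterm \<Rightarrow> 'k) \<in> tspan p C" "f \<in> tspan p B"
  shows "f \<in> tspan p C"
  using assms(2) by (induction rule: tspan_induct) (auto intro: assms(1) tspan.ideal tspan.smult tspan_add)

lemma tspan_repr: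
  assumes "f \<in> tspan p B"
  obtains g where "fin_supp g" "{t. g t \<noteq> 0} \<subseteq> B" "f - g \<in> GDN_ideal p"
proof -
  have "\<exists>g. fin_supp g \<and> {t. g t \<noteq> 0} \<subseteq> B \<and> f - g \<in> GDN_ideal p"
    using assms
  proof (induction rule: tspan_induct)
    case (gen b)
    then show ?case using subsp_0[OF subsp_GDN_ideal]
      by (intro exI[of _ "lc_single b"]) (auto simp: lc_single_def[abs_def] fin_supp_def split: if_splits)
  next
    case (ideal f)
    then show ?case by (intro exI[of _ 0]) (auto simp: fun_apps fin_supp_def)
  next
    case (add f1 f2)
    then obtain g1 g2 where g: "fin_supp g1" "{t. g1 t \<noteq> 0} \<subseteq> B" "f1 - g1 \<in> GDN_ideal p"
      "fin_supp g2" "{t. g2 t \<noteq> 0} \<subseteq> B" "f2 - g2 \<in> GDN_ideal p" by auto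
    have "f1 + f2 - (g1 + g2) \<in> GDN_ideal p"
      using subsp_add[OF subsp_GDN_ideal g(3,6)] by (simp add: algebra_simps)
    moreover have "{t. (g1 + g2) t \<noteq> 0} \<subseteq> B" using g(2,5) by (simp add: subset_iff plus_fun_apply) (metis add.right_neutral)
    ultimately show ?case using fin_supp_add[OF g(1,4)] by blast
  next
    case (smult f c)
    then obtain g where g: "fin_supp g" "{t. g t \<noteq> 0} \<subseteq> B" "f - g \<in> GDN_ideal p" by auto
    have "(\<lambda>t. c * f t) - (\<lambda>t. c * g t) = (\<lambda>t. c * (f - g) t)"
      by (simp add: fun_eq_iff fun_apps right_diff_distrib)
    then show ?case using g
      by (intro exI[of _ "\<lambda>t. c * g t"]) (auto intro: subsp_smult[OF subsp_GDN_ideal])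
  qed
  then show thesis using that by blast
qed


section \<open>The ordinary case\<close>

abbreviation GDN0 :: "('y gterm \<Rightarrow> 'k::field) set" where
  "GDN0 \<equiv> GDN_ideal (\<lambda>_. False)"

text \<open>A product of rows without any order condition; \<open>Tab\<close> selects those
  satisfying \<open>is_tab\<close>.\<close>

abbreviation tabl :: "'y \<Rightarrow> 'y list list \<Rightarrow> 'y gterm" where
  "tabl a ls \<equiv> lcomb (GV a) (map rcomb ls)"

lemma psign_simps [simp]: "psign False b = 1" "psign a False = 1" "psign True True = - 1"
  by (auto simp: psign_def)

lemma gpar_False [simp]: "gpar (\<lambda>_. False) t = False"
  by (induction t) auto

lemma lcomb_append [simp]: "lcomb t (us @ vs) = lcomb (lcomb t us) vs"
  by (induction us arbitrary: t) auto

lemma rcomb_Cons [simp]: "l \<noteq> [] \<Longrightarrow> rcomb (b # l) = GO (GV b) (rcomb l)"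
  by (cases l) auto

lemma GDN0_lsym:
  "(lc_single (GO x (GO y z)) - lc_single (GO (GO x y) z))
    - (lc_single (GO y (GO x z)) - lc_single (GO (GO y x) z)) \<in> GDN0"
  using GDN_lsym[of x y z "\<lambda>_. False"] by simp

lemma GDN0_rcom: "lc_single (GO (GO x y) z) - lc_single (GO (GO x z) y) \<in> GDN0"
  using GDN_rcom[of x y z "\<lambda>_. False"] by simp

section \<open>Permuting rows\<close>

definition tcong :: "('y gterm \<Rightarrow> 'k::field) set \<Rightarrow> 'y gterm \<Rightarrow> 'y gterm \<Rightarrow> bool" where
  "tcong S s t \<longleftrightarrow> lc_single s - lc_single t \<in> S"

lemma tcong_refl [simp]: "subsp S \<Longrightarrow> tcong S s s"
  by (simp add: tcong_def subsp_0)

lemma tcong_trans: "subsp S \<Longrightarrow> tcong S s t \<Longrightarrow> tcong S t u \<Longrightarrow> tcong S s u"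
  unfolding tcong_def by (rule subsp_diff_trans)

lemma tcong_mem: "subsp S \<Longrightarrow> tcong S s t \<Longrightarrow> lc_single t \<in> S \<Longrightarrow> lc_single s \<in> S"
  unfolding tcong_def using subsp_add[of S "lc_single s - lc_single t" "lc_single t"] by simp

lemma tcong_GDN0_lcomb:
  assumes "tcong (GDN0 :: ('y gterm \<Rightarrow> 'k::field) set) s t"
  shows "tcong (GDN0 :: ('y gterm \<Rightarrow> 'k) set) (lcomb s us) (lcomb t us)"
  using assms
proof (induction us arbitrary: s t)
  case (Cons u us)
  have "lin (\<lambda>s. lc_single (GO s u)) (lc_single s - lc_single t) \<in> (GDN0 :: ('y gterm \<Rightarrow> 'k) set)"
    using Cons.prems by (intro GDN_ideal.rmul) (simp add: tcong_def)
  then show ?case using Cons.IH by (simp add: tcong_def)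
qed simp

text \<open>Adjacent transpositions generate all permutations: the first letter is carried step by
  step to its place, then the rest is treated behind a fixed prefix.\<close>

lemma perm_by_swaps:
  assumes refl: "\<And>xs. R xs xs"
    and trans: "\<And>xs ys zs. R xs ys \<Longrightarrow> R ys zs \<Longrightarrow> R xs zs"
    and swap: "\<And>us x y vs. R (us @ x # y # vs) (us @ y # x # vs)"
    and eq: "mset xs = mset ys"
  shows "R xs ys"
proof -
  have move: "R (us @ x # as @ bs) (us @ as @ x # bs)" for us x as bs
  proof (induction as arbitrary: us)
    case (Cons a as)
    have "R (us @ x # a # as @ bs) (us @ a # x # as @ bs)" by (rule swap)
    moreover have "R ((us @ [a]) @ x # as @ bs) ((us @ [a]) @ as @ x # bs)" by (rule Cons)
    ultimately show ?case using trans by auto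
  qed (simp add: refl)
  have "R (us @ xs) (us @ ys)" for us
    using eq
  proof (induction xs arbitrary: us ys)
    case (Cons x xs)
    then have "x \<in> set ys" by (metis list.set_intros(1) set_mset_mset)
    then obtain as bs where ys: "ys = as @ x # bs" by (auto simp: in_set_conv_decomp)
    with Cons.prems have "mset xs = mset (as @ bs)" by simp
    then have "R ((us @ [x]) @ xs) ((us @ [x]) @ as @ bs)" by (rule Cons.IH)
    then show ?case using move[of us x as bs] trans ys by auto
  qed (simp add: refl)
  from this[of "[]"] show ?thesis by simp
qed

text \<open>Right commutativity swaps two adjacent factors, and the later ones act by right
  multiplication, which preserves the ideal. The factors may be arbitrary terms, not only
  rows.\<close>

lemma tcong_rows_perm:
  assumes "mset us = mset vs"
  shows "tcong GDN0 (lcomb s us) (lcomb s vs :: 'y gterm)"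
  by (rule perm_by_swaps[where R="\<lambda>us vs. tcong GDN0 (lcomb s us) (lcomb s vs)", OF _ _ _ assms])
    (auto simp: subsp_GDN_ideal intro: tcong_trans[OF subsp_GDN_ideal] tcong_GDN0_lcomb,
     simp add: tcong_GDN0_lcomb GDN0_rcom tcong_def[of _ "GO (GO _ _) _"])

text \<open>A filtration decreasing in \<open>n\<close>. Empty rows are excluded because
  \<open>rcomb []\<close> is \<open>undefined\<close>.\<close>

definition gspan :: "nat \<Rightarrow> ('y gterm \<Rightarrow> 'k::field) set" where
  "gspan n = tspan (\<lambda>_. False) {tabl a ls | a ls. n \<le> length ls \<and> [] \<notin> set ls}"

lemma subsp_gspan [simp]: "subsp (gspan n)"
  by (simp add: gspan_def subsp_tspan)

lemma gspan_fin_supp [simp]: "f \<in> gspan n \<Longrightarrow> fin_supp f"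
  by (simp add: gspan_def tspan_fin_supp)

lemma gspan_ideal: "f \<in> GDN0 \<Longrightarrow> f \<in> gspan n"
  by (simp add: gspan_def tspan.ideal)

lemma gspan_tabl: "n \<le> length ls \<Longrightarrow> [] \<notin> set ls \<Longrightarrow> lc_single (tabl a ls) \<in> gspan n"
  unfolding gspan_def by (rule tspan.gen) auto

lemma gspan_lin:
  fixes f :: "'y gterm \<Rightarrow> 'k::field"
  assumes "f \<in> gspan n" "subsp S" "\<And>f :: 'y gterm \<Rightarrow> 'k. f \<in> GDN0 \<Longrightarrow> lin h f \<in> S"
    "\<And>a ls. n \<le> length ls \<Longrightarrow> [] \<notin> set ls \<Longrightarrow> h (tabl a ls) \<in> S"
  shows "lin h f \<in> S"
  by (rule tspan_lin[OF assms(1)[unfolded gspan_def] assms(2,3)]) (use assms(4) in auto)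

lemma gspan_mono:
  assumes "m \<le> n" "f \<in> gspan n"
  shows "f \<in> gspan m"
  using gspan_lin[OF assms(2), of "gspan m" lc_single] assms
  by (simp add: lin_id gspan_ideal GDN_ideal_fin_supp gspan_tabl)

lemma gspan_rmul:
  assumes "f \<in> gspan n" "l \<noteq> []"
  shows "lin (\<lambda>s. lc_single (GO s (rcomb l))) f \<in> gspan (Suc n)"
proof (rule gspan_lin[OF assms(1)])
  fix a and ls :: "'a list list" assume "n \<le> length ls" "[] \<notin> set ls"
  then have "lc_single (tabl a (ls @ [l])) \<in> gspan (Suc n)"
    using assms(2) by (intro gspan_tabl) auto
  then show "lc_single (GO (tabl a ls) (rcomb l)) \<in> gspan (Suc n)" by simp
qed (auto intro: gspan_ideal GDN_ideal.rmul)

text \<open>With \<open>t\<close> the product of all rows but the last one \<open>m\<close>, left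
  symmetry gives \<open>b(tm) = (bt)m + t(bm) - (tb)m\<close>. The first term is handled by
  induction, the second prolongs the last row, the third has one more row. The maximum with 1 covers
  the lone letter, which turns into a row.\<close>

lemma gspan_lmul_tabl:
  assumes "[] \<notin> set ls"
  shows "(lc_single (GO (GV b) (tabl a ls)) :: 'y gterm \<Rightarrow> 'k::field) \<in> gspan (max (length ls) 1)"
  using assms
proof (induction ls rule: rev_induct)
  case Nil
  have "lc_single (tabl b [[a]]) \<in> gspan 1" by (rule gspan_tabl) auto
  then show ?case by simp
next
  case (snoc l ls)
  then have l: "l \<noteq> []" "[] \<notin> set ls" by auto
  show ?case
  proof (cases "ls = []")
    case True
    have "lc_single (tabl b [a # l]) \<in> gspan 1" by (rule gspan_tabl) auto
    then show ?thesis using True l by simp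
  next
    case False
    let ?n = "Suc (length ls)"
    let ?t = "tabl a ls"
    let ?m = "rcomb l"
    have "max (length ls) 1 = length ls" using False by (cases ls) auto
    with snoc.IH l have "(lc_single (GO (GV b) ?t) :: 'y gterm \<Rightarrow> 'k) \<in> gspan (length ls)" by simp
    from gspan_rmul[OF this l(1)] have 1: "(lc_single (GO (GO (GV b) ?t) ?m) :: 'y gterm \<Rightarrow> 'k) \<in> gspan ?n" by simp
    have "lc_single (tabl a (ls @ [b # l])) \<in> gspan ?n" using l by (intro gspan_tabl) auto
    then have 2: "lc_single (GO ?t (GO (GV b) ?m)) \<in> gspan ?n" using l by simp
    have "lc_single (tabl a (ls @ [[b], l])) \<in> gspan ?n" using l by (intro gspan_tabl) auto
    then have 3: "lc_single (GO (GO ?t (GV b)) ?m) \<in> gspan ?n" by simp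
    let ?x = "lc_single (GO (GV b) (GO ?t ?m)) :: 'y gterm \<Rightarrow> 'k"
    have "(?x - lc_single (GO (GO (GV b) ?t) ?m)) -
       (lc_single (GO ?t (GO (GV b) ?m)) - lc_single (GO (GO ?t (GV b)) ?m)) \<in> gspan ?n"
      by (rule gspan_ideal[OF GDN0_lsym])
    from subsp_add[OF subsp_gspan this subsp_add[OF subsp_gspan 1 subsp_diff[OF subsp_gspan 2 3]]]
    have "?x \<in> gspan ?n" by simp
    then show ?thesis by simp
  qed
qed

lemma gspan_lmul:
  assumes "f \<in> gspan n"
  shows "lin (\<lambda>s. lc_single (GO (GV b) s)) f \<in> gspan (max n 1)"
proof (rule gspan_lin[OF assms])
  fix a and ls :: "'a list list" assume "n \<le> length ls" "[] \<notin> set ls"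
  then show "lc_single (GO (GV b) (tabl a ls)) \<in> gspan (max n 1)"
    by (intro gspan_mono[OF _ gspan_lmul_tabl]) auto
qed (auto intro: gspan_ideal GDN_ideal.lmul)

lemma gspan_rmuls:
  assumes "(lc_single s :: 'y gterm \<Rightarrow> 'k::field) \<in> gspan 0" "[] \<notin> set ls"
  shows "(lc_single (lcomb s (map rcomb ls)) :: 'y gterm \<Rightarrow> 'k) \<in> gspan 0"
  using assms
proof (induction ls arbitrary: s)
  case (Cons l ls)
  then have "lin (\<lambda>s. lc_single (GO s (rcomb l))) (lc_single s) \<in> (gspan (Suc 0) :: ('y gterm \<Rightarrow> 'k) set)"
    by (intro gspan_rmul) auto
  then have "(lc_single (GO s (rcomb l)) :: 'y gterm \<Rightarrow> 'k) \<in> gspan 0" using gspan_mono[of 0 1] by simp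
  then show ?case using Cons by simp
qed simp

text \<open>For a product \<open>u \<circ> v\<close>, write \<open>u\<close> by rows, move
  \<open>v\<close> next to the head letter by right commutativity, and absorb it there with
  \<open>gspan_lmul\<close>.\<close>

lemma gspan_all: "(lc_single t :: 'y gterm \<Rightarrow> 'k::field) \<in> gspan 0"
proof (induction t)
  case (GV a)
  have "lc_single (tabl a []) \<in> gspan 0" by (rule gspan_tabl) auto
  then show ?case by simp
next
  case (GO u v)
  let ?lc = "lc_single :: 'y gterm \<Rightarrow> 'y gterm \<Rightarrow> 'k"
  have "lin (\<lambda>s. ?lc (GO s v)) (?lc u) \<in> gspan 0"
  proof (rule gspan_lin[OF GO(1)])
    fix a and ls :: "'y list list" assume ls: "[] \<notin> set ls"
    have "lin (\<lambda>s. ?lc (GO (GV a) s)) (?lc v) \<in> gspan (max 0 1)"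
      using GO(2) by (rule gspan_lmul)
    then have "?lc (GO (GV a) v) \<in> gspan 0" using gspan_mono[of 0 1] by simp
    then have "?lc (lcomb (GO (GV a) v) (map rcomb ls)) \<in> gspan 0"
      using ls by (rule gspan_rmuls)
    moreover have "tcong (gspan 0 :: ('y gterm \<Rightarrow> 'k) set) (lcomb (GV a) (map rcomb ls @ [v])) (lcomb (GV a) (v # map rcomb ls))"
      unfolding tcong_def
      by (rule gspan_ideal, fold tcong_def, rule tcong_rows_perm) simp
    ultimately show "?lc (GO (tabl a ls) v) \<in> gspan 0"
      by (auto intro: tcong_mem[OF subsp_gspan])
  qed (auto intro: gspan_ideal GDN_ideal.rmul)
  then show ?case by simp
qed

text \<open>The type argument \<open>K\<close> carries the coefficient field, which the terms do not determine.\<close>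

definition sim :: "'k::field itself \<Rightarrow> nat \<Rightarrow> 'y gterm \<Rightarrow> 'y gterm \<Rightarrow> bool" where
  "sim K n s t \<longleftrightarrow> lc_single s - lc_single t \<in> (gspan n :: ('y gterm \<Rightarrow> 'k) set)"

lemma sim_refl [simp]: "sim K n s s"
  by (simp add: sim_def subsp_0)

lemma sim_sym: "sim K n s t \<Longrightarrow> sim K n t s"
  unfolding sim_def by (rule subsp_diff_sym[OF subsp_gspan])

lemma sim_trans [trans]: "sim K n s t \<Longrightarrow> sim K n t u \<Longrightarrow> sim K n s u"
  unfolding sim_def by (rule subsp_diff_trans[OF subsp_gspan])

lemma sim_rows_perm: "mset us = mset vs \<Longrightarrow> sim K n (lcomb s us) (lcomb s vs)"
  unfolding sim_def by (rule gspan_ideal, fold tcong_def, rule tcong_rows_perm)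

text \<open>The error terms receive the additional rows as well, so the level rises with their
  number.\<close>

lemma sim_rmul:
  fixes K :: "'k::field itself"
  assumes "sim K n s t" "[] \<notin> set ls"
  shows "sim K (n + length ls) (lcomb s (map rcomb ls)) (lcomb t (map rcomb ls))"
  using assms
proof (induction ls arbitrary: s t n)
  case (Cons l ls)
  let ?lc = "lc_single :: 'b gterm \<Rightarrow> 'b gterm \<Rightarrow> 'k"
  have "lin (\<lambda>s. ?lc (GO s (rcomb l))) (?lc s - ?lc t) \<in> gspan (Suc n)"
    using Cons.prems by (intro gspan_rmul) (auto simp: sim_def)
  then have "sim K (Suc n) (GO s (rcomb l)) (GO t (rcomb l))" by (simp add: sim_def)
  from Cons.IH[OF this] Cons.prems show ?case by simp
qed simp

lemma sim_lmul:
  fixes K :: "'k::field itself" and s :: "'y gterm"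
  assumes "sim K n s t" "n > 0"
  shows "sim K n (GO (GV b) s) (GO (GV b) t)"
proof -
  let ?lc = "lc_single :: 'y gterm \<Rightarrow> 'y gterm \<Rightarrow> 'k"
  have "lin (\<lambda>s. ?lc (GO (GV b) s)) (?lc s - ?lc t) \<in> gspan (max n 1)"
    using assms by (intro gspan_lmul) (auto simp: sim_def)
  moreover have "max n 1 = n" using assms by auto
  ultimately show ?thesis by (simp add: sim_def)
qed

text \<open>This is left symmetry: the two remaining terms \<open>(a \<circ> b) \<circ> l\<close>
  and \<open>(b \<circ> a) \<circ> l\<close> have two rows and so vanish at level 2.\<close>

lemma sim_swap_letters:
  assumes "l \<noteq> []"
  shows "sim K 2 (GO (GV a) (GO (GV b) (rcomb l))) (GO (GV b) (GO (GV a) (rcomb l)))"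
proof -
  have "lc_single (tabl c [[d], l]) \<in> gspan 2" for c d
    using assms by (intro gspan_tabl) auto
  then have "lc_single (GO (GO (GV c) (GV d)) (rcomb l)) \<in> gspan 2" for c d by simp
  from subsp_add[OF subsp_gspan gspan_ideal[OF GDN0_lsym[of "GV a" "GV b" "rcomb l"]]
      subsp_diff[OF subsp_gspan this[of a b] this[of b a]]]
  show ?thesis by (simp add: sim_def)
qed

text \<open>The term has \<open>Suc (length ls)\<close> rows, so the error is one step deeper than
  the term itself.\<close>

lemma sim_swap_head:
  assumes "l \<noteq> []" "[] \<notin> set ls"
  shows "sim K (Suc (Suc (length ls))) (tabl a ((b # l) # ls)) (tabl b ((a # l) # ls))"
  using sim_rmul[OF sim_swap_letters[OF assms(1)] assms(2), of K a b] assms(1) by simp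

text \<open>Left symmetry applies below the letters already passed, since left multiplication by a
  letter keeps the level. The suffix \<open>l\<close> is nonempty because the last letter of a row
  never takes part in an exchange.\<close>

lemma sim_row_perm:
  assumes "mset us = mset vs" "l \<noteq> []" "[] \<notin> set ls"
  shows "sim K (Suc (Suc (length ls))) (tabl a ((us @ l) # ls)) (tabl a ((vs @ l) # ls))"
proof -
  have "sim K 2 (rcomb (us @ l)) (rcomb (vs @ l))"
  proof (rule perm_by_swaps[where R="\<lambda>us vs. sim K 2 (rcomb (us @ l)) (rcomb (vs @ l))", OF _ _ _ assms(1)])
    fix us x y vs
    show "sim K 2 (rcomb ((us @ x # y # vs) @ l)) (rcomb ((us @ y # x # vs) @ l))"
    proof (induction us)
      case Nil
      have "vs @ l \<noteq> []" using assms(2) by simp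
      from sim_swap_letters[OF this] this show ?case by simp
    next
      case (Cons u us)
      from sim_lmul[OF this, of u] show ?case by simp
    qed
  qed (auto intro: sim_trans)
  from sim_rmul[OF sim_lmul[OF this, of a] assms(3)] assms(2)
  show ?thesis by simp
qed

text \<open>What rearrangement leaves unchanged in a row. Read as a letter of the differential
  algebra, it is the last letter derived as often as the row is long.\<close>

definition foot :: "'y list \<Rightarrow> 'y \<times> nat" where
  "foot l = (last l, length l)"

section \<open>Moving letters between rows\<close>

lemma butlast_append' [simp]: "l \<noteq> [] \<Longrightarrow> butlast (us @ l) = us @ butlast l"
  by (simp add: butlast_append)

text \<open>Move the row containing \<open>x\<close> to the first place, bring \<open>x\<close> to
  the front of that row, and exchange it with the head.\<close>

lemma sim_bring_to_head:
  assumes "x \<in> set (tab_chain a ls)" "[] \<notin> set ls"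
  shows "\<exists>ls'. [] \<notin> set ls' \<and> sim K (Suc (length ls)) (tabl a ls) (tabl x ls') \<and>
    mset (map foot ls') = mset (map foot ls) \<and> mset (tab_chain x ls') = mset (tab_chain a ls)"
proof (cases "x = a")
  case True
  then show ?thesis using assms by auto
next
  case False
  with assms(1) obtain l where l: "l \<in> set ls" "x \<in> set (butlast l)"
    by (auto simp: tab_chain_def)
  then obtain us vs where "butlast l = us @ x # vs" by (auto simp: in_set_conv_decomp)
  moreover have "l \<noteq> []" using assms(2) l by auto
  ultimately have leq: "l = us @ x # vs @ [last l]"
    by (metis append_butlast_last_id append_Cons append_assoc)
  define v where "v = vs @ [last l]"
  have v: "v \<noteq> []" "l = us @ x # v" using leq by (auto simp: v_def)
  from l obtain A B where ls: "ls = A @ l # B" by (auto simp: in_set_conv_decomp)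
  have AB: "[] \<notin> set (A @ B)" and len: "length ls = Suc (length (A @ B))"
    using assms(2) ls by auto
  have "sim K (Suc (length ls)) (tabl a ls) (tabl a (((us @ [x]) @ v) # A @ B))"
    by (rule sim_rows_perm) (simp add: ls v)
  also have "sim K (Suc (length ls)) \<dots> (tabl a (((x # us) @ v) # A @ B))"
    unfolding len by (rule sim_row_perm) (use v AB in auto)
  also have "\<dots> = tabl a ((x # us @ v) # A @ B)" by simp
  also have "sim K (Suc (length ls)) (tabl a ((x # us @ v) # A @ B)) (tabl x ((a # us @ v) # A @ B))"
    unfolding len by (rule sim_swap_head) (use v AB in auto)
  finally have "sim K (Suc (length ls)) (tabl a ls) (tabl x ((a # us @ v) # A @ B))" .
  moreover have "mset (map foot ((a # us @ v) # A @ B)) = mset (map foot ls)"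
    using v by (simp add: ls foot_def)
  moreover have "mset (tab_chain x ((a # us @ v) # A @ B)) = mset (tab_chain a ls)"
    using v(1) by (simp add: ls tab_chain_def v(2))
  ultimately show ?thesis using AB by (intro exI[of _ "(a # us @ v) # A @ B"]) auto
qed

lemma length_eq_of_mset_map: "mset (map f xs) = mset (map f ys) \<Longrightarrow> length xs = length ys"
  by (metis length_map size_mset)

text \<open>The row is moved to the end, where right multiplication applies, and then back to the
  front.\<close>

lemma sim_add_row:
  assumes "sim K (Suc (length ls)) (tabl a ls) (tabl b ms)" "l \<noteq> []"
  shows "sim K (Suc (Suc (length ls))) (tabl a (l # ls)) (tabl b (l # ms))"
proof -
  have "sim K n (tabl c (l # ks)) (tabl c (ks @ [l]))" for n c ks
    by (rule sim_rows_perm) simp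
  moreover have "sim K (Suc (Suc (length ls))) (tabl a (ls @ [l])) (tabl b (ms @ [l]))"
    using sim_rmul[OF assms(1), of "[l]"] assms(2) by simp
  ultimately show ?thesis by (meson sim_sym sim_trans)
qed

text \<open>The tail \<open>zs\<close> is already correct and \<open>x\<close> is to stand just
  before it. If \<open>x\<close> is not in the row, it is first made the head using the other rows
  alone, then exchanged into the row.\<close>

lemma sim_place_letter:
  assumes "x \<in> set ys \<union> set (tab_chain a ls)" "ys \<noteq> []" "zs \<noteq> []" "[] \<notin> set ls"
  shows "\<exists>a1 ys1 ls1. [] \<notin> set ls1 \<and>
    sim K (Suc (Suc (length ls))) (tabl a ((ys @ zs) # ls)) (tabl a1 ((ys1 @ x # zs) # ls1)) \<and>
    Suc (length ys1) = length ys \<and> mset (map foot ls1) = mset (map foot ls) \<and>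
    mset ys1 + {#x#} + mset (tab_chain a1 ls1) = mset ys + mset (tab_chain a ls)"
proof (cases "x \<in> set ys")
  case True
  then obtain us vs where ys: "ys = us @ x # vs" by (auto simp: in_set_conv_decomp)
  have "sim K (Suc (Suc (length ls))) (tabl a ((ys @ zs) # ls)) (tabl a (((us @ vs @ [x]) @ zs) # ls))"
    by (rule sim_row_perm) (use assms in \<open>auto simp: ys\<close>)
  then show ?thesis using assms
    by (intro exI[of _ a] exI[of _ "us @ vs"] exI[of _ ls]) (auto simp: ys)
next
  case False
  with assms obtain ls1 where ls1: "[] \<notin> set ls1" "sim K (Suc (length ls)) (tabl a ls) (tabl x ls1)"
    "mset (map foot ls1) = mset (map foot ls)" "mset (tab_chain x ls1) = mset (tab_chain a ls)"
    using sim_bring_to_head[of x a ls K] by blast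
  have len: "length ls1 = length ls" using ls1(3) by (rule length_eq_of_mset_map)
  obtain y ys' where ys: "ys = y # ys'" using assms(2) by (cases ys) auto
  let ?n = "Suc (Suc (length ls))"
  have "sim K ?n (tabl a ((ys @ zs) # ls)) (tabl x ((ys @ zs) # ls1))"
    by (rule sim_add_row) (use ls1 assms in auto)
  also have "\<dots> = tabl x ((y # ys' @ zs) # ls1)" by (simp add: ys)
  also have "sim K ?n (tabl x ((y # ys' @ zs) # ls1)) (tabl y ((x # ys' @ zs) # ls1))"
    unfolding len[symmetric] by (rule sim_swap_head) (use ls1 assms in auto)
  also have "\<dots> = tabl y (((x # ys') @ zs) # ls1)" by simp
  also have "sim K ?n (tabl y (((x # ys') @ zs) # ls1)) (tabl y (((ys' @ [x]) @ zs) # ls1))"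
    unfolding len[symmetric] by (rule sim_row_perm) (use ls1 assms in auto)
  finally show ?thesis using ls1 ys
    by (intro exI[of _ y] exI[of _ ys'] exI[of _ ls1]) (auto simp: tab_chain_def)
qed

text \<open>The row is filled from right to left; each placed letter joins the fixed tail
  \<open>zs\<close>.\<close>

lemma sim_place_row:
  assumes "mset xs \<subseteq># mset ys + mset (tab_chain a ls)" "length xs = length ys" "zs \<noteq> []" "[] \<notin> set ls"
  shows "\<exists>a1 ls1. [] \<notin> set ls1 \<and>
    sim K (Suc (Suc (length ls))) (tabl a ((ys @ zs) # ls)) (tabl a1 ((xs @ zs) # ls1)) \<and>
    mset (map foot ls1) = mset (map foot ls) \<and>
    mset xs + mset (tab_chain a1 ls1) = mset ys + mset (tab_chain a ls)"
  using assms
proof (induction xs arbitrary: ys a ls zs rule: rev_induct)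
  case Nil
  then show ?case by (intro exI[of _ a] exI[of _ ls]) auto
next
  case (snoc x xs)
  have "x \<in># mset ys + mset (tab_chain a ls)"
    using snoc.prems(1) by (rule mset_subset_eqD) simp
  then have "x \<in> set ys \<union> set (tab_chain a ls)" by simp
  moreover have "ys \<noteq> []" using snoc.prems by auto
  ultimately obtain a1 ys1 ls1 where 1: "[] \<notin> set ls1"
    "sim K (Suc (Suc (length ls))) (tabl a ((ys @ zs) # ls)) (tabl a1 ((ys1 @ x # zs) # ls1))"
    "Suc (length ys1) = length ys" "mset (map foot ls1) = mset (map foot ls)"
    "mset ys1 + {#x#} + mset (tab_chain a1 ls1) = mset ys + mset (tab_chain a ls)"
    using sim_place_letter[of x ys a ls zs K] snoc.prems by blast
  have len: "length ls1 = length ls" using 1(4) by (rule length_eq_of_mset_map)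
  have "mset xs \<subseteq># mset ys1 + mset (tab_chain a1 ls1)"
    using snoc.prems(1) unfolding 1(5)[symmetric] by (simp add: add_mset_commute)
  moreover have "length xs = length ys1" using snoc.prems 1(3) by simp
  ultimately obtain a2 ls2 where 2: "[] \<notin> set ls2"
    "sim K (Suc (Suc (length ls1))) (tabl a1 ((ys1 @ x # zs) # ls1)) (tabl a2 ((xs @ x # zs) # ls2))"
    "mset (map foot ls2) = mset (map foot ls1)"
    "mset xs + mset (tab_chain a2 ls2) = mset ys1 + mset (tab_chain a1 ls1)"
    using snoc.IH[of ys1 a1 ls1 "x # zs"] 1(1) by auto
  have "sim K (Suc (Suc (length ls))) (tabl a ((ys @ zs) # ls)) (tabl a2 (((xs @ [x]) @ zs) # ls2))"
    using sim_trans[OF 1(2) 2(2)[unfolded len]] by simp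
  moreover have "mset (xs @ [x]) + mset (tab_chain a2 ls2) = mset ys + mset (tab_chain a ls)"
    using 1(5) 2(4) by (simp add: ac_simps)
  ultimately show ?case using 2(1,3) 1(4) by (intro exI[of _ a2] exI[of _ ls2]) simp
qed

text \<open>Some row of \<open>ls'\<close> has the same foot as the first row of \<open>ls\<close>.
  Fill the latter with the letters of the former, then split this common row off and use induction
  on the number of rows.\<close>

theorem sim_tabl:
  assumes "[] \<notin> set ls" "[] \<notin> set ls'"
    "mset (map foot ls) = mset (map foot ls')" "mset (tab_chain a ls) = mset (tab_chain a' ls')"
  shows "sim K (Suc (length ls)) (tabl a ls) (tabl a' ls')"
  using assms
proof (induction "length ls" arbitrary: a ls a' ls')
  case 0
  then show ?case by (auto simp: tab_chain_def)
next
  case (Suc n)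
  then obtain l ls1 where ls: "ls = l # ls1" and n: "n = length ls1" by (cases ls) auto
  have "foot l \<in># mset (map foot ls')" using Suc.prems(3)[symmetric] ls by simp
  then obtain l' where "l' \<in> set ls'" and l': "foot l' = foot l" by auto
  then obtain A B where ls': "ls' = A @ l' # B" by (auto simp: in_set_conv_decomp)
  have ne: "l \<noteq> []" "l' \<noteq> []" "[] \<notin> set ls1" "[] \<notin> set (A @ B)" using Suc.prems ls ls' by auto
  let ?z = "[last l]"
  have leq: "l = butlast l @ ?z" "l' = butlast l' @ ?z"
    using ne l' append_butlast_last_id[of l] append_butlast_last_id[of l'] by (simp_all add: foot_def)
  have chain: "mset (butlast l') + mset (tab_chain a' (A @ B)) = mset (butlast l) + mset (tab_chain a ls1)"
    using Suc.prems(4) by (simp add: tab_chain_def ls ls' ac_simps)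
  have "mset (butlast l') \<subseteq># mset (butlast l) + mset (tab_chain a ls1)"
    by (simp flip: chain)
  moreover have "length (butlast l') = length (butlast l)" using l' by (simp add: foot_def)
  ultimately obtain a2 ls2 where 2: "[] \<notin> set ls2"
    "sim K (Suc (Suc (length ls1))) (tabl a ((butlast l @ ?z) # ls1)) (tabl a2 ((butlast l' @ ?z) # ls2))"
    "mset (map foot ls2) = mset (map foot ls1)"
    "mset (butlast l') + mset (tab_chain a2 ls2) = mset (butlast l) + mset (tab_chain a ls1)"
    using sim_place_row[of "butlast l'" "butlast l" a ls1 ?z K] ne by auto
  have len: "length ls2 = length ls1" using 2(3) by (rule length_eq_of_mset_map)
  have "sim K (Suc (length ls2)) (tabl a2 ls2) (tabl a' (A @ B))"
  proof (rule Suc.hyps(1))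
    show "mset (map foot ls2) = mset (map foot (A @ B))"
      using 2(3) Suc.prems(3) l' by (simp add: ls ls')
    show "mset (tab_chain a2 ls2) = mset (tab_chain a' (A @ B))"
      using 2(4) chain by (metis add_left_cancel)
  qed (use n len 2 ne in auto)
  then have "sim K (Suc (Suc (length ls2))) (tabl a2 (l' # ls2)) (tabl a' (l' # A @ B))"
    using ne by (intro sim_add_row)
  moreover have "sim K (Suc (Suc (length ls2))) (tabl a' (l' # A @ B)) (tabl a' ls')"
    by (rule sim_rows_perm) (simp add: ls')
  ultimately have "sim K (Suc (Suc (length ls1))) (tabl a2 (l' # ls2)) (tabl a' ls')"
    unfolding len by (rule sim_trans)
  then show ?case using sim_trans[OF 2(2)] leq ls by simp
qed


section \<open>Signs of words\<close>

definition lpar :: "('y \<Rightarrow> bool) \<Rightarrow> 'y list \<Rightarrow> bool" where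
  "lpar q w \<longleftrightarrow> odd (length (filter q w))"

lemma lpar_simps [simp]:
  "lpar q [] = False" "lpar q (x # w) = (q x \<noteq> lpar q w)" "lpar q (u @ v) = (lpar q u \<noteq> lpar q v)"
  by (auto simp: lpar_def)

lemma psign_mult: "psign a b * psign a c = (psign a (b \<noteq> c) :: 'k::comm_ring_1)"
  "psign b a * psign c a = (psign (b \<noteq> c) a :: 'k::comm_ring_1)"
  by (auto simp: psign_def)

lemma psign_self [simp]:
  "psign a b * psign a b = (1 :: 'k::comm_ring_1)" "psign a b * (psign a b * c) = (c :: 'k)"
  by (auto simp: psign_def)

text \<open>These are the linear functionals on words that respect supercommutativity of the
  letters.\<close>

definition alternating :: "('y \<Rightarrow> bool) \<Rightarrow> ('y list \<Rightarrow> 'k::comm_ring_1) \<Rightarrow> bool" where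
  "alternating q g \<longleftrightarrow> (\<forall>us x y vs. g (us @ x # y # vs) = psign (q x) (q y) * g (us @ y # x # vs))"

lemma alternatingD: "alternating q g \<Longrightarrow> g (us @ x # y # vs) = psign (q x) (q y) * g (us @ y # x # vs)"
  unfolding alternating_def by blast

lemma alternating_letter:
  assumes "alternating q g"
  shows "g (us @ x # bs @ vs) = psign (q x) (lpar q bs) * g (us @ bs @ x # vs)"
proof (induction bs arbitrary: us)
  case (Cons b bs)
  have "g (us @ x # b # bs @ vs) = psign (q x) (q b) * g ((us @ [b]) @ x # bs @ vs)"
    unfolding append.append_Cons append_assoc append_Nil by (rule alternatingD[OF assms])
  also have "g ((us @ [b]) @ x # bs @ vs) = psign (q x) (lpar q bs) * g ((us @ [b]) @ bs @ x # vs)"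
    by (rule Cons.IH)
  also have "psign (q x) (q b) * (psign (q x) (lpar q bs) * g ((us @ [b]) @ bs @ x # vs)) =
      psign (q x) (q b \<noteq> lpar q bs) * g ((us @ [b]) @ bs @ x # vs)"
    by (simp only: psign_mult(1) mult.assoc[symmetric])
  finally show ?case unfolding append.append_Cons append_assoc append_Nil lpar_simps .
qed (simp add: psign_def)

lemma alternating_block:
  assumes "alternating q g"
  shows "g (us @ as @ bs @ vs) = psign (lpar q as) (lpar q bs) * g (us @ bs @ as @ vs)"
proof (induction as arbitrary: us)
  case (Cons a as)
  have "g (us @ a # as @ bs @ vs) = psign (lpar q as) (lpar q bs) * g (us @ a # bs @ as @ vs)"
    using Cons[of "us @ [a]"] unfolding append.append_Cons append_assoc append_Nil .
  also have "g (us @ a # bs @ as @ vs) = psign (q a) (lpar q bs) * g (us @ bs @ a # as @ vs)"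
    by (rule alternating_letter[OF assms])
  also have "psign (lpar q as) (lpar q bs) * (psign (q a) (lpar q bs) * g (us @ bs @ a # as @ vs)) =
      psign (lpar q as \<noteq> q a) (lpar q bs) * g (us @ bs @ a # as @ vs)"
    by (simp only: psign_mult(2) mult.assoc[symmetric])
  also have "(lpar q as \<noteq> q a) = lpar q (a # as)" by auto
  finally show ?case unfolding append.append_Cons .
qed (simp add: psign_def)

lemma alternating_context:
  assumes "alternating q g"
  shows "alternating q (\<lambda>w. g (us @ w @ vs))"
  unfolding alternating_def
proof (intro allI)
  fix as x y bs
  show "g (us @ (as @ x # y # bs) @ vs) = psign (q x) (q y) * g (us @ (as @ y # x # bs) @ vs)"
    using alternatingD[OF assms, of "us @ as" x y "bs @ vs"] by simp
qed

text \<open>Each of the two letters crosses the word between them once, so these signs cancel and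
  only the sign of the mutual crossing remains.\<close>

lemma alternating_exchange:
  assumes "alternating q g" "q x" "q y"
  shows "g (us @ x # vs @ y # ws) = - g (us @ y # vs @ x # ws)"
proof -
  have "g (us @ [x] @ (vs @ [y]) @ ws) = psign (lpar q [x]) (lpar q (vs @ [y])) * g (us @ (vs @ [y]) @ [x] @ ws)"
    by (rule alternating_block[OF assms(1)])
  moreover have "g (us @ vs @ [y] @ x # ws) = psign (lpar q vs) (lpar q [y]) * g (us @ [y] @ vs @ x # ws)"
    by (rule alternating_block[OF assms(1)])
  ultimately show ?thesis using assms(2,3) by (cases "lpar q vs") simp_all
qed

primrec invsgn :: "('y::linorder \<Rightarrow> bool) \<Rightarrow> 'y list \<Rightarrow> 'k::comm_ring_1" where
  "invsgn q [] = 1"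
| "invsgn q (x # w) = (\<Prod>y\<leftarrow>w. if q x \<and> q y \<and> y < x then - 1 else 1) * invsgn q w"

lemma invsgn_square: "invsgn q w * invsgn q w = (1 :: 'k::comm_ring_1)"
proof (induction w)
  case (Cons x w)
  have sq: "(\<Prod>y\<leftarrow>w. f y) * (\<Prod>y\<leftarrow>w. f y) = (1 :: 'k)" if "\<And>y. f y * f y = 1" for f w
  proof (induction w)
    case (Cons y w)
    have "f y * P * (f y * P) = (f y * f y) * (P * P)" for P by (simp add: mult_ac)
    then show ?case using Cons that by simp
  qed simp
  have eq: "(\<Prod>y\<leftarrow>w. if q x \<and> q y \<and> y < x then - 1 else 1) *
        (\<Prod>y\<leftarrow>w. if q x \<and> q y \<and> y < x then - 1 else 1) = (1 :: 'k)"
    by (rule sq) simp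
  have prod: "P * S * (P * S) = (P * P) * (S * S)" for P S :: 'k by (simp add: mult_ac)
  show ?case unfolding invsgn.simps by (rule trans[OF prod]) (simp add: eq Cons)
qed simp

lemma invsgn_nonzero: "invsgn q w \<noteq> (0 :: 'k::field)"
  using invsgn_square[of q w, where 'k='k] by auto

text \<open>Only the pair \<open>x\<close>, \<open>y\<close> changes its relative order; as the
  letters differ, exactly one of the two orders is an inversion.\<close>

lemma invsgn_swap:
  assumes "x \<noteq> y"
  shows "invsgn q (us @ x # y # vs) = (psign (q x) (q y) * invsgn q (us @ y # x # vs) :: 'k::comm_ring_1)"
proof (induction us)
  case Nil
  define P where "P z = (\<Prod>v\<leftarrow>vs. if q z \<and> q v \<and> v < z then - 1 else (1 :: 'k))" for z
  have *: "(if q x \<and> q y \<and> y < x then - 1 else 1) =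
      psign (q x) (q y) * (if q y \<and> q x \<and> x < y then - 1 else (1 :: 'k))"
    using assms by (auto simp: psign_def)
  show ?case by (simp add: * mult_ac flip: P_def)
next
  case (Cons u us)
  have "(\<Prod>v\<leftarrow>us @ x # y # vs. f v) = (\<Prod>v\<leftarrow>us @ y # x # vs. f v)" for f :: "_ \<Rightarrow> 'k"
    by (simp add: mult.left_commute)
  then show ?case unfolding append.append_Cons invsgn.simps Cons by (simp only: mult.left_commute)
qed

text \<open>Up to sign, the coefficient of the monomial with content \<open>M\<close>. It serves
  twice: on position labels it supplies the signs of the rewriting, on leading words it detects a
  single tableau.\<close>

definition msgn :: "('y::linorder \<Rightarrow> bool) \<Rightarrow> 'y multiset \<Rightarrow> 'y list \<Rightarrow> 'k::comm_ring_1" where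
  "msgn q M w = (if mset w = M then invsgn q w else 0)"

text \<open>Swapping two adjacent copies of an odd letter fixes the word but would have to reverse
  the sign, so odd letters must be simple in \<open>M\<close>.\<close>

lemma alternating_msgn:
  assumes "\<And>y. q y \<Longrightarrow> count M y \<le> 1"
  shows "alternating q (msgn q M)"
  unfolding alternating_def
proof (intro allI)
  fix us x y vs
  show "msgn q M (us @ x # y # vs) = psign (q x) (q y) * msgn q M (us @ y # x # vs)"
  proof (cases "x = y")
    case True
    have "\<not> q x" if M: "mset (us @ x # y # vs) = M"
    proof
      assume "q x"
      then have "count M x \<le> 1" by (rule assms)
      moreover have "count M x \<ge> 2" unfolding M[symmetric] True by simp
      ultimately show False by simp
    qed
    then show ?thesis by (auto simp: msgn_def psign_def True)
  next
    case False
    have "mset (us @ x # y # vs) = mset (us @ y # x # vs)" by simp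
    then show ?thesis unfolding msgn_def invsgn_swap[OF False, of q us vs] by (simp del: mset.simps mset_append)
  qed
qed

lemma msgn_length: "msgn q (mset u) w \<noteq> 0 \<Longrightarrow> length w = length u"
  by (auto simp: msgn_def dest: mset_eq_length split: if_splits)

section \<open>Relabelling\<close>

fun leaves :: "'y gterm \<Rightarrow> 'y list" where
  "leaves (GV a) = [a]"
| "leaves (GO u v) = leaves u @ leaves v"

lemma gpar_map_gterm [simp]: "gpar p (map_gterm l t) = lpar (p \<circ> l) (leaves t)"
  by (induction t) auto

definition relab :: "('y \<Rightarrow> 'x) \<Rightarrow> ('y list \<Rightarrow> 'k) \<Rightarrow> 'y gterm \<Rightarrow> 'x gterm \<Rightarrow> 'k::field" where
  "relab l g t = (\<lambda>s. g (leaves t) * lc_single (map_gterm l t) s)"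

lemma fin_supp_relab [simp]: "fin_supp (relab l g t)"
  by (simp add: relab_def)

text \<open>Weighted by an alternating function of their leaves, the ordinary identities between terms
  turn into the super identities, so that signs need not be tracked.\<close>

lemma relab_ideal:
  fixes f :: "'y gterm \<Rightarrow> 'k::field"
  assumes "f \<in> GDN0" "alternating (p \<circ> l) g"
  shows "lin (relab l g) f \<in> GDN_ideal p"
  using assms
proof (induction arbitrary: g rule: GDN_ideal.induct)
  case (lsym x y z)
  let ?x = "map_gterm l x" and ?y = "map_gterm l y" and ?z = "map_gterm l z"
  have "g (leaves x @ leaves y @ leaves z) =
      psign (gpar p ?x) (gpar p ?y) * g (leaves y @ leaves x @ leaves z)"
    using alternating_block[OF lsym, of "[]" "leaves x" "leaves y" "leaves z"]
    by (simp only: append_Nil gpar_map_gterm)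
  then have "relab l g (GO x (GO y z)) - relab l g (GO (GO x y) z)
      - (relab l g (GO y (GO x z)) - relab l g (GO (GO y x) z)) =
    (\<lambda>t. g (leaves x @ leaves y @ leaves z) *
      ((lc_single (GO ?x (GO ?y ?z)) - lc_single (GO (GO ?x ?y) ?z))
    - (\<lambda>t. psign (gpar p ?x) (gpar p ?y) * (lc_single (GO ?y (GO ?x ?z)) - lc_single (GO (GO ?y ?x) ?z)) t)) t)"
    by (simp add: relab_def fun_eq_iff fun_apps algebra_simps)
  also have "\<dots> \<in> GDN_ideal p"
    by (rule subsp_smult[OF subsp_GDN_ideal GDN_lsym])
  finally have "lin (relab l g) ((lc_single (GO x (GO y z)) - lc_single (GO (GO x y) z))
      - (lc_single (GO y (GO x z)) - lc_single (GO (GO y x) z))) \<in> GDN_ideal p" by simp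
  then show ?case by (simp only: fun_diff_def gpar_False psign_simps mult_1)
next
  case (rcom x y z)
  let ?x = "map_gterm l x" and ?y = "map_gterm l y" and ?z = "map_gterm l z"
  have "g (leaves x @ leaves y @ leaves z) =
      psign (gpar p ?y) (gpar p ?z) * g (leaves x @ leaves z @ leaves y)"
    using alternating_block[OF rcom, of "leaves x" "leaves y" "leaves z" "[]"]
    by (simp only: append_Nil2 gpar_map_gterm)
  then have "relab l g (GO (GO x y) z) - relab l g (GO (GO x z) y) =
    (\<lambda>t. g (leaves x @ leaves y @ leaves z) *
      (lc_single (GO (GO ?x ?y) ?z) - (\<lambda>t. psign (gpar p ?y) (gpar p ?z) * lc_single (GO (GO ?x ?z) ?y) t)) t)"
    by (simp add: relab_def fun_eq_iff fun_apps algebra_simps)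
  also have "\<dots> \<in> GDN_ideal p"
    by (rule subsp_smult[OF subsp_GDN_ideal GDN_rcom])
  finally have "lin (relab l g) (lc_single (GO (GO x y) z) - lc_single (GO (GO x z) y)) \<in> GDN_ideal p"
    by simp
  then show ?case by (simp only: fun_diff_def gpar_False psign_simps mult_1)
next
  case zero
  then show ?case by (simp add: subsp_0[OF subsp_GDN_ideal] flip: zero_fun_def)
next
  case (add f1 f2)
  then have "lin (relab l g) (f1 + f2) \<in> GDN_ideal p"
    by (simp add: GDN_ideal_fin_supp subsp_add[OF subsp_GDN_ideal])
  then show ?case by (simp add: plus_fun_def)
next
  case (smult f c)
  then show ?case by (simp add: GDN_ideal_fin_supp subsp_smult[OF subsp_GDN_ideal])
next
  case (lmul f u)
  \<comment> \<open>The factor \<open>u\<close> is absorbed into the weight, which remains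
    alternating on words inserted in a fixed context. This is why the induction ranges over all
    \<open>g\<close>.\<close>
  have "alternating (p \<circ> l) (\<lambda>w. g (leaves u @ w))"
    using alternating_context[OF lmul.prems, of "leaves u" "[]"] by (simp only: append_Nil2)
  then have "lin (\<lambda>s. lc_single (GO (map_gterm l u) s)) (lin (relab l (\<lambda>w. g (leaves u @ w))) f) \<in> GDN_ideal p"
    by (intro GDN_ideal.lmul lmul.IH)
  then show ?case using GDN_ideal_fin_supp[OF lmul.hyps]
    by (simp add: lin_lin) (simp add: relab_def)
next
  case (rmul f u)
  have "alternating (p \<circ> l) (\<lambda>w. g (w @ leaves u))"
    using alternating_context[OF rmul.prems, of "[]" "leaves u"] by (simp only: append_Nil)
  then have "lin (\<lambda>s. lc_single (GO s (map_gterm l u))) (lin (relab l (\<lambda>w. g (w @ leaves u))) f) \<in> GDN_ideal p"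
    by (intro GDN_ideal.rmul rmul.IH)
  then show ?case using GDN_ideal_fin_supp[OF rmul.hyps]
    by (simp add: lin_lin) (simp add: relab_def)
qed

section \<open>Row products with labelled letters\<close>

lemma leaves_rcomb [simp]: "l \<noteq> [] \<Longrightarrow> leaves (rcomb l) = l"
  by (induction l rule: rcomb.induct) auto

lemma leaves_lcomb: "leaves (lcomb t us) = leaves t @ concat (map leaves us)"
  by (induction us arbitrary: t) auto

lemma leaves_tabl: "[] \<notin> set ls \<Longrightarrow> leaves (tabl a ls) = a # concat ls"
  by (simp add: leaves_lcomb) (induction ls; auto)

lemma map_gterm_rcomb: "l \<noteq> [] \<Longrightarrow> map_gterm f (rcomb l) = rcomb (map f l)"
  by (induction l rule: rcomb.induct) auto

lemma map_gterm_lcomb: "map_gterm f (lcomb t us) = lcomb (map_gterm f t) (map (map_gterm f) us)"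
  by (induction us arbitrary: t) auto

lemma map_gterm_tabl: "[] \<notin> set ls \<Longrightarrow> map_gterm f (tabl a ls) = tabl (f a) (map (map f) ls)"
proof -
  assume "[] \<notin> set ls"
  then have "map (map_gterm f \<circ> rcomb) ls = map (rcomb \<circ> map f) ls"
    by (induction ls) (auto simp: map_gterm_rcomb)
  then show ?thesis by (simp only: map_gterm_lcomb map_map gterm.map)
qed

text \<open>The number \<open>N\<close> of letters is recorded because it bounds the number of rows
  and thereby the depth of the descent.\<close>

definition tabls :: "nat \<Rightarrow> nat \<Rightarrow> 'x gterm set" where
  "tabls N n = {tabl a ls | a ls. n \<le> length ls \<and> [] \<notin> set ls \<and> Suc (length (concat ls)) = N}"

text \<open>\<open>gspan\<close> does not record how many letters a term has. The weight vanishes on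
  words of other lengths and so cuts out the part with \<open>N\<close> letters.\<close>

lemma relab_gspan:
  assumes "f \<in> gspan n" "alternating (p \<circ> l) g" "\<And>w. g w \<noteq> 0 \<Longrightarrow> length w = N"
  shows "lin (relab l g) f \<in> tspan p (tabls N n)"
proof (rule gspan_lin[OF assms(1) subsp_tspan])
  fix a and ls :: "'a list list" assume ls: "n \<le> length ls" "[] \<notin> set ls"
  show "relab l g (tabl a ls) \<in> tspan p (tabls N n)"
  proof (cases "g (leaves (tabl a ls)) = 0")
    case True
    then have "relab l g (tabl a ls) = 0" by (simp add: relab_def zero_fun_def)
    then show ?thesis by (simp add: subsp_0[OF subsp_tspan])
  next
    case False
    then have "length (a # concat ls) = N" using assms(3)[of "a # concat ls"] ls leaves_tabl[of ls a] by auto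
    moreover have "length (concat (map (map l) ls)) = length (concat ls)" by (simp flip: map_concat)
    ultimately have "tabl (l a) (map (map l) ls) \<in> tabls N n"
      using ls by (auto simp: tabls_def intro!: exI[of _ "l a"] exI[of _ "map (map l) ls"])
    then show ?thesis using ls
      by (auto simp: relab_def map_gterm_tabl intro!: tspan.smult tspan.gen)
  qed
qed (auto intro: tspan.ideal relab_ideal assms)


section \<open>Tableaux span\<close>

text \<open>Chain and feet are constrained separately, by decreasing orders that are strict at odd
  letters; how the chain is cut into rows does not enter. A tableau can thus be assembled from a
  sorted chain and sorted feet.\<close>

lemma is_tab_iff:
  "is_tab p a ls \<longleftrightarrow> [] \<notin> set ls
   \<and> sorted_wrt (\<lambda>x y. y < x \<or> y = x \<and> \<not> p x) (tab_chain a ls)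
   \<and> sorted_wrt (\<lambda>(b, h) (b', h'). h' < h \<or> h' = h \<and> (b' < b \<or> b' = b \<and> \<not> p b)) (map foot ls)"
    (is "_ \<longleftrightarrow> _ \<and> ?C \<and> ?F")
proof -
  have pt: "(y < x \<or> y = x \<and> \<not> p x) \<longleftrightarrow> y \<le> x \<and> (p x \<longrightarrow> p y \<longrightarrow> x \<noteq> y)" for x y
    by (auto simp: order_le_less)
  have C: "?C \<longleftrightarrow> sorted_wrt (\<lambda>x y. y \<le> x) (tab_chain a ls)
     \<and> (\<forall>i j. i < j \<longrightarrow> j < length (tab_chain a ls)
          \<longrightarrow> p (tab_chain a ls ! i) \<longrightarrow> p (tab_chain a ls ! j)
          \<longrightarrow> tab_chain a ls ! i \<noteq> tab_chain a ls ! j)"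
    unfolding sorted_wrt_iff_nth_less pt by blast
  \<comment> \<open>Rows are only compared with their neighbours in \<open>is_tab\<close>;
    transitivity extends this to all pairs.\<close>
  have tr: "transp (\<lambda>(b, h :: nat) (b', h'). h' < h \<or> h' = h \<and> (b' < b \<or> b' = b \<and> \<not> p b))"
    by (rule transpI) (auto split: prod.splits intro: less_trans)
  have pt': "h' < h \<or> h' = h \<and> (b' < b \<or> b' = b \<and> \<not> p b) \<longleftrightarrow>
      h' \<le> h \<and> (h = h' \<longrightarrow> b' \<le> b) \<and> (p b \<longrightarrow> p b' \<longrightarrow> h = h' \<longrightarrow> b \<noteq> b')" for h h' :: nat and b b'
    by (auto simp: order_le_less)
  have F: "?F \<longleftrightarrow> (\<forall>i. Suc i < length ls \<longrightarrow> length (ls ! Suc i) \<le> length (ls ! i))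
   \<and> (\<forall>i. Suc i < length ls \<longrightarrow> length (ls ! i) = length (ls ! Suc i)
          \<longrightarrow> last (ls ! Suc i) \<le> last (ls ! i))
   \<and> (\<forall>i. Suc i < length ls \<longrightarrow> p (last (ls ! i)) \<longrightarrow> p (last (ls ! Suc i))
          \<longrightarrow> length (ls ! i) = length (ls ! Suc i)
          \<longrightarrow> last (ls ! i) \<noteq> last (ls ! Suc i))"
    unfolding sorted_wrt_iff_nth_Suc_transp[OF tr]
    by (simp add: foot_def pt' del: not_less not_le) blast
  show ?thesis unfolding C F is_tab_def by auto
qed

section \<open>Assembling a tableau from its chain and its feet\<close>

lemma sorted_wrt_rev_sort_key:
  assumes "distinct xs"
  shows "sorted_wrt (\<lambda>x y. f y \<le> f x \<and> x \<noteq> y) (rev (sort_key f xs))"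
proof -
  have "sorted (map f (sort_key f xs))" by simp
  moreover have "distinct (sort_key f xs)" using assms by simp
  ultimately show ?thesis
    unfolding sorted_wrt_rev sorted_map by (auto simp: sorted_wrt_iff_nth_less nth_eq_iff_index_eq)
qed

lemma unconcat:
  assumes "concat ls = map f ns"
  shows "\<exists>ls0. concat ls0 = ns \<and> map (map f) ls0 = ls"
  using assms
proof (induction ls arbitrary: ns)
  case (Cons l ls)
  then obtain as bs where "ns = as @ bs" "l = map f as" "concat ls = map f bs"
    by (auto simp: append_eq_map_conv)
  with Cons.IH[of bs] show ?case by (metis concat.simps(2) list.simps(9))
qed auto

text \<open>Cut \<open>c\<close> into pieces of lengths \<open>h - 1\<close> and close each piece
  with its foot.\<close>

lemma exists_rows:
  assumes "\<And>b h. (b, h) \<in> set F \<Longrightarrow> h > 0" "length c = (\<Sum>(b, h)\<leftarrow>F. h - 1)"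
  shows "\<exists>ls. [] \<notin> set ls \<and> map foot ls = F \<and> concat (map butlast ls) = c"
  using assms
proof (induction F arbitrary: c)
  case (Cons bh F)
  obtain b h where bh: "bh = (b, h)" by force
  have h: "h > 0" using Cons.prems(1)[of b h] bh by simp
  have "length (drop (h - 1) c) = (\<Sum>(b, h)\<leftarrow>F. h - 1)"
    using Cons.prems(2) bh by simp
  then obtain ls where ls: "[] \<notin> set ls" "map foot ls = F" "concat (map butlast ls) = drop (h - 1) c"
    using Cons.IH[of "drop (h - 1) c"] Cons.prems(1) by auto
  have "foot (take (h - 1) c @ [b]) = (b, h)"
    using Cons.prems(2) bh h by (simp add: foot_def)
  then show ?case using ls
    by (intro exI[of _ "(take (h - 1) c @ [b]) # ls"]) (auto simp: bh)
qed auto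

lemma length_concat_butlast: "length (concat (map butlast ls)) = (\<Sum>(b, h)\<leftarrow>map foot ls. h - 1)"
  by (induction ls) (auto simp: foot_def)

lemma mset_leaves_tabl:
  assumes "[] \<notin> set ls"
  shows "mset (a # concat ls) = mset (tab_chain a ls) + mset (map fst (map foot ls))"
proof -
  have "mset (concat ls) = mset (concat (map butlast ls)) + mset (map fst (map foot ls))"
    using assms
  proof (induction ls)
    case (Cons l ls)
    then have "mset l = mset (butlast l) + {#last l#}"
      by (metis append_butlast_last_id list.set_intros(1) mset.simps mset_append)
    then show ?case using Cons by (simp add: foot_def)
  qed simp
  then show ?thesis by (simp add: tab_chain_def)
qed

text \<open>Each row has a letter of its own and the head is one more. At this level the filtration
  ends.\<close>

lemma tabls_full:
  assumes "N \<le> n"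
  shows "tabls N n = {}"
proof -
  have "length ls \<le> length (concat ls)" if "[] \<notin> set ls" for ls :: "'x list list"
    using that
  proof (induction ls)
    case (Cons l ls)
    then have "length l \<ge> 1" by (cases l) auto
    then show ?case using Cons by simp
  qed simp
  then show ?thesis using assms by (fastforce simp: tabls_def)
qed

lemma count_mset_distinct: "distinct xs \<Longrightarrow> count (mset xs) y \<le> 1"
  by (simp add: distinct_count_atmost_1)

lemma mset_map_involution:
  assumes "distinct xs" "inj f" "f ` set xs = set xs"
  shows "mset (map f xs) = mset xs"
proof -
  have "distinct (map f xs)" using assms by (simp add: distinct_map inj_on_subset[of f UNIV])
  with assms show ?thesis by (simp only: set_map flip: set_eq_iff_mset_eq_distinct)
qed

lemma image_involution:
  assumes "\<And>z. z \<in> S \<Longrightarrow> f z \<in> S" "\<And>z. f (f z) = z"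
  shows "f ` S = S"
  using assms by (metis image_eqI image_subsetI subsetI subset_antisym)

lemma exchange_labels:
  assumes "alternating q g" "distinct w" "x \<in> set w" "y \<in> set w" "x \<noteq> y" "q x" "q y"
  shows "g (map (id(x := y, y := x)) w) = - g w"
proof -
  have *: "g (map (id(x := y, y := x)) w) = - g w"
    if w: "w = us @ x # vs @ y # ws" "distinct w" "x \<noteq> y" "q x" "q y" for us vs ws x y
  proof -
    have "map (id(x := y, y := x)) us = us" "map (id(x := y, y := x)) vs = vs"
      "map (id(x := y, y := x)) ws = ws"
      using w by (auto intro!: map_idI)
    then have "map (id(x := y, y := x)) w = us @ y # vs @ x # ws" using w by simp
    then show ?thesis using alternating_exchange[OF assms(1) w(5,4), of us vs ws] w(1) by simp
  qed
  obtain us w' where w: "w = us @ x # w'" using assms(3) by (auto simp: in_set_conv_decomp)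
  then consider "y \<in> set w'" | "y \<in> set us" using assms by auto
  then show ?thesis
  proof cases
    case 1
    then obtain vs ws where "w' = vs @ y # ws" by (auto simp: in_set_conv_decomp)
    then show ?thesis using w assms by (intro *) auto
  next
    case 2
    then obtain us' vs where "us = us' @ y # vs" by (auto simp: in_set_conv_decomp)
    then have "g (map (id(y := x, x := y)) w) = - g w" using w assms by (intro *) auto
    then show ?thesis using assms(5) by (simp add: fun_upd_twist)
  qed
qed

text \<open>The letters are labelled by their positions, so that the rearrangements of the ordinary case
  apply. If two equal odd letters obstruct a supertableau, exchanging their labels fixes the term and
  reverses its sign, whence twice the term lies one step deeper.\<close>

lemma tabl_in_span:
  fixes p :: "'x::linorder \<Rightarrow> bool"
  assumes two: "(2 :: 'k::field) \<noteq> 0" and "[] \<notin> set ls"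
  shows "(lc_single (tabl a ls) :: 'x gterm \<Rightarrow> 'k) \<in> tspan p (Tab p)"
  using assms(2)
\<comment> \<open>The measure is the number of letters minus the number of rows: error terms keep
  the former and increase the latter.\<close>
proof (induction "Suc (length (concat ls)) - length ls" arbitrary: a ls rule: less_induct)
  case (less ls a)
  define N where "N = Suc (length (concat ls))"
  define n where "n = length ls"
  let ?S = "tspan p (Tab p) :: ('x gterm \<Rightarrow> 'k) set"
  have next_step: "f \<in> ?S" if "f \<in> tspan p (tabls N (Suc n))" for f :: "'x gterm \<Rightarrow> 'k"
  proof (rule tspan_subset[OF _ that])
    fix t :: "'x gterm" assume t: "t \<in> tabls N (Suc n)"
    then obtain b ms where ms: "t = tabl b ms" "Suc n \<le> length ms" "[] \<notin> set ms"
      "Suc (length (concat ms)) = N" by (auto simp: tabls_def)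
    \<comment> \<open>Subtraction of naturals truncates; this bound makes the measure really
      drop.\<close>
    have "Suc n < N" using t tabls_full[of N "Suc n"] by (cases "N \<le> Suc n") auto
    then show "(lc_single t :: 'x gterm \<Rightarrow> 'k) \<in> ?S"
      using ms less.hyps[of ms b] by (simp add: n_def N_def)
  qed
  define w where "w = a # concat ls"
  define l where "l = nth w"
  have "map l [0..<N] = w" unfolding l_def by (metis N_def length_Cons map_nth w_def)
  then have l: "l 0 = a" "concat ls = map l [1..<N]"
    by (auto simp: w_def N_def upt_rec[of 0] simp del: upt_Suc)
  obtain ls0 where ls0: "concat ls0 = [1..<N]" "map (map l) ls0 = ls"
    using unconcat[OF l(2)] by blast
  have ne0: "[] \<notin> set ls0" using less.prems ls0(2) by force
  have len0: "length ls0 = n" using ls0(2) by (auto simp: n_def)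
  have w0: "0 # concat ls0 = [0..<N]" using ls0(1) by (simp add: N_def upt_rec[of 0] del: upt_Suc)
  define M where "M = mset [0..<N]"
  define g where "g = (msgn (p \<circ> l) M :: nat list \<Rightarrow> 'k)"
  have alt: "alternating (p \<circ> l) g"
    unfolding g_def by (rule alternating_msgn) (simp only: M_def count_mset_distinct distinct_upt)
  have g0: "g (0 # concat ls0) \<noteq> 0"
    unfolding g_def msgn_def w0 M_def if_P[OF refl] by (rule invsgn_nonzero)
  define c0 where "c0 = tab_chain 0 ls0"
  define F0 where "F0 = map foot ls0"
  have M: "M = mset c0 + mset (map fst F0)"
    using mset_leaves_tabl[OF ne0, of 0] unfolding w0 M_def c0_def F0_def .
  have "distinct (c0 @ map fst F0)"
    using M by (metis M_def distinct_upt mset_append mset_eq_imp_distinct_iff)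
  then have dist: "distinct c0" "distinct (map fst F0)" "set c0 \<inter> set (map fst F0) = {}" by auto
  have lT: "map_gterm l (tabl 0 ls0) = tabl a ls"
    using ne0 ls0 l by (simp add: map_gterm_tabl)
  \<comment> \<open>The ordinary rearrangement holds between the labelled products up to more rows;
    relabelling turns it into a weighted relation whose error lies in the span by the induction
    hypothesis.\<close>
  have key: "(\<lambda>t. g (0 # concat ls0) * lc_single (tabl a ls) t)
      - (\<lambda>t. g (a1 # concat ls1) * lc_single (tabl (l a1) (map (map l) ls1)) t) \<in> ?S"
    if "[] \<notin> set ls1" "mset (tab_chain a1 ls1) = mset c0" "mset (map foot ls1) = mset F0" for a1 ls1
  proof -
    have "sim TYPE('k) (Suc n) (tabl 0 ls0) (tabl a1 ls1)"
      unfolding len0[symmetric] by (rule sim_tabl) (use that ne0 in \<open>simp_all add: c0_def F0_def\<close>)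
    moreover have "length v = N" if "g v \<noteq> 0" for v
      using msgn_length[OF that[unfolded g_def M_def]] by simp
    ultimately have "lin (relab l g) (lc_single (tabl 0 ls0) - lc_single (tabl a1 ls1)) \<in> tspan p (tabls N (Suc n))"
      using alt by (intro relab_gspan) (auto simp: sim_def)
    then show ?thesis
      using that(1) ne0 by (intro next_step) (simp add: relab_def lT leaves_tabl map_gterm_tabl)
  qed
  show ?case
  proof (cases "\<exists>x y. x \<noteq> y \<and> l x = l y \<and> p (l x) \<and>
      (x \<in> set c0 \<and> y \<in> set c0 \<or> (\<exists>h. (x, h) \<in> set F0 \<and> (y, h) \<in> set F0))")
    case True
    then obtain x y where xy: "x \<noteq> y" "l x = l y" "p (l x)"
      "x \<in> set c0 \<and> y \<in> set c0 \<or> (\<exists>h. (x, h) \<in> set F0 \<and> (y, h) \<in> set F0)" by blast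
    define \<tau> where "\<tau> = id(x := y, y := x)"
    have \<tau>: "l \<circ> \<tau> = l" "inj \<tau>" "inj (map_prod \<tau> (id :: nat \<Rightarrow> nat))" "\<tau> (\<tau> z) = z" for z
      using xy by (auto simp: \<tau>_def fun_eq_iff inj_def)
    let ?ls1 = "map (map \<tau>) ls0"
    have "tab_chain (\<tau> 0) ?ls1 = map \<tau> c0"
      by (simp add: c0_def tab_chain_def map_concat map_butlast comp_def)
    \<comment> \<open>Labels of the chain and of the feet are disjoint, so the exchange permutes the
      part containing both labels and fixes the other part.\<close>
    moreover have "\<tau> ` set c0 = set c0"
    proof (cases "x \<in> set c0 \<and> y \<in> set c0")
      case True
      then show ?thesis using \<tau>(4) by (intro image_involution) (auto simp: \<tau>_def)
    next
      case False
      then have "x \<in> set (map fst F0)" "y \<in> set (map fst F0)" using xy(4) by force+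
      then have "x \<notin> set c0" "y \<notin> set c0" using dist(3) by blast+
      then show ?thesis using \<tau>(4) by (intro image_involution) (auto simp: \<tau>_def)
    qed
    ultimately have 1: "mset (tab_chain (\<tau> 0) ?ls1) = mset c0"
      using mset_map_involution[OF dist(1) \<tau>(2)] by simp
    have "map foot ?ls1 = map (map_prod \<tau> id) F0"
      using ne0 by (auto simp: F0_def foot_def intro!: last_map)
    moreover have "map_prod \<tau> id ` set F0 = set F0"
    proof (cases "\<exists>h. (x, h) \<in> set F0 \<and> (y, h) \<in> set F0")
      case True
      then obtain h where h: "(x, h) \<in> set F0" "(y, h) \<in> set F0" by blast
      have "h' = h" if "(x, h') \<in> set F0 \<or> (y, h') \<in> set F0" for h'
        using that h eq_key_imp_eq_value[OF dist(2)] by metis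
      then have "map_prod \<tau> id (b, k) \<in> set F0" if "(b, k) \<in> set F0" for b k
        using that h by (cases "b = x"; cases "b = y") (auto simp: \<tau>_def)
      then show ?thesis using \<tau>(4) by (intro image_involution) auto
    next
      case False
      then have "x \<in> set c0" "y \<in> set c0" using xy(4) by auto
      then have "x \<notin> set (map fst F0)" "y \<notin> set (map fst F0)" using dist(3) by blast+
      then have "map_prod \<tau> id (b, k) \<in> set F0" if "(b, k) \<in> set F0" for b k
        using that by (cases "b = x"; cases "b = y") (force simp: \<tau>_def)+
      then show ?thesis using \<tau>(4) by (intro image_involution) auto
    qed
    ultimately have 2: "mset (map foot ?ls1) = mset F0"
      using mset_map_involution[OF _ \<tau>(3), of F0] dist(2) by (simp add: distinct_map)
    have 3: "map (map l) ?ls1 = ls" "l (\<tau> 0) = a"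
      using \<tau>(1) ls0(2) l(1) by (auto simp: fun_eq_iff)
    have "set (0 # concat ls0) = set c0 \<union> set (map fst F0)"
      using M unfolding w0 M_def by (metis mset_append set_append set_mset_mset)
    then have "x \<in> set (0 # concat ls0)" "y \<in> set (0 # concat ls0)" using xy(4) by force+
    then have "g (map \<tau> (0 # concat ls0)) = - g (0 # concat ls0)"
      unfolding \<tau>_def using xy w0 by (intro exchange_labels[OF alt]) auto
    then have 4: "g (\<tau> 0 # concat ?ls1) = - g (0 # concat ls0)" by (simp add: map_concat)
    have "[] \<notin> set ?ls1" using ne0 by auto
    \<comment> \<open>Here the characteristic enters: \<open>key\<close> compares the term with
      itself under opposite weights, and the resulting factor 2 has to be cancelled.\<close>
    from key[OF this 1 2, unfolded 3 4]
    have "(\<lambda>t. (2 * g (0 # concat ls0)) * (lc_single (tabl a ls) :: 'x gterm \<Rightarrow> 'k) t) \<in> ?S"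
      by (simp add: fun_diff_def algebra_simps)
    then show ?thesis
      by (rule subsp_smultD[OF subsp_tspan]) (use two g0 in simp)
  next
    case False
    define c1 where "c1 = rev (sort_key l c0)"
    \<comment> \<open>Height comes first in the key, since tableaux compare last letters only among
      rows of equal length.\<close>
    define F1 where "F1 = rev (sort_key (\<lambda>(b, h). (h, l b)) F0)"
    have m: "mset c1 = mset c0" "mset F1 = mset F0" by (simp_all add: c1_def F1_def)
    have "c1 \<noteq> []" using m(1) by (auto simp: c0_def tab_chain_def)
    then obtain a1 c2 where c1: "c1 = a1 # c2" by (cases c1) auto
    have "length c1 = length c0" using m(1) by (rule mset_eq_length)
    then have "length c2 = (\<Sum>(b, h)\<leftarrow>F0. h - 1)"
      using length_concat_butlast[of ls0] by (simp add: c1 c0_def tab_chain_def F0_def)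
    also have "\<dots> = (\<Sum>(b, h)\<leftarrow>F1. h - 1)"
      by (metis (no_types) m(2) mset_map sum_mset_sum_list)
    finally have len: "length c2 = (\<Sum>(b, h)\<leftarrow>F1. h - 1)" .
    have pos: "h > 0" if "(b, h) \<in> set F1" for b h
    proof -
      have "(b, h) \<in> set F0" using that m(2) by (metis set_mset_mset)
      then show ?thesis using ne0 by (auto simp: F0_def foot_def)
    qed
    have "\<exists>ls1. [] \<notin> set ls1 \<and> map foot ls1 = F1 \<and> concat (map butlast ls1) = c2"
      using len by (intro exists_rows pos)
    then obtain ls1 where ls1: "[] \<notin> set ls1" "map foot ls1 = F1"
      "concat (map butlast ls1) = c2" by blast
    have ch: "tab_chain a1 ls1 = c1" by (simp add: tab_chain_def c1 ls1)
    have ch': "tab_chain (l a1) (map (map l) ls1) = map l c1"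
      by (simp add: ch[symmetric] tab_chain_def map_concat map_butlast comp_def)
    have ft': "map foot (map (map l) ls1) = map (\<lambda>(b, h). (l b, h)) F1"
      using ls1(1) by (auto simp: ls1(2)[symmetric] foot_def intro!: last_map)
    have sets: "set c1 = set c0" "set F1 = set F0" using m by (metis set_mset_mset)+
    have even: "\<not> p (l x)" if "x \<in> set c0" "y \<in> set c0" "x \<noteq> y" "l x = l y" for x y
      using False that by blast
    have even': "\<not> p (l x)" if "(x, h) \<in> set F0" "(y, h) \<in> set F0" "x \<noteq> y" "l x = l y" for x y h
      using False that by blast
    have "sorted_wrt (\<lambda>x y. l y \<le> l x \<and> x \<noteq> y) c1"
      unfolding c1_def by (rule sorted_wrt_rev_sort_key[OF dist(1)])
    then have "sorted_wrt (\<lambda>x y. y < x \<or> y = x \<and> \<not> p x) (map l c1)"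
      unfolding sorted_wrt_map
      by (rule sorted_wrt_mono_rel[rotated]) (auto simp: order_le_less sets dest: even)
    moreover have "distinct F0" using dist(2) by (simp add: distinct_map)
    then have "sorted_wrt (\<lambda>x y. (case y of (b, h) \<Rightarrow> (h, l b)) \<le> (case x of (b, h) \<Rightarrow> (h, l b)) \<and> x \<noteq> y) F1"
      unfolding F1_def by (rule sorted_wrt_rev_sort_key)
    then have "sorted_wrt (\<lambda>(b, h) (b', h'). h' < h \<or> h' = h \<and> (b' < b \<or> b' = b \<and> \<not> p b))
       (map (\<lambda>(b, h). (l b, h)) F1)"
      unfolding sorted_wrt_map
      by (rule sorted_wrt_mono_rel[rotated])
        (auto simp: less_eq_prod_def order_le_less sets dest: even')
    ultimately have "is_tab p (l a1) (map (map l) ls1)"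
      unfolding is_tab_iff ch' ft' using ls1(1) by auto
    then have "lc_single (tabl (l a1) (map (map l) ls1)) \<in> ?S"
      unfolding Tab_def by (intro tspan.gen) blast
    then have "(\<lambda>t. g (a1 # concat ls1) * lc_single (tabl (l a1) (map (map l) ls1)) t) \<in> ?S"
      by (rule subsp_smult[OF subsp_tspan])
    from subsp_add[OF subsp_tspan key[OF ls1(1), of a1] this]
    have "(\<lambda>t. g (0 # concat ls0) * (lc_single (tabl a ls) :: 'x gterm \<Rightarrow> 'k) t) \<in> ?S"
      using m ls1(2) ch by simp
    then show ?thesis by (rule subsp_smultD[OF subsp_tspan]) (rule g0)
  qed
qed

lemma exists_labelling: "leaves t = map l ns \<Longrightarrow> \<exists>t0. leaves t0 = ns \<and> map_gterm l t0 = t"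
proof (induction t arbitrary: ns)
  case (GV a)
  then obtain b where "ns = [b]" "a = l b" by auto
  then show ?case by (intro exI[of _ "GV b"]) auto
next
  case (GO u v)
  then obtain as bs where *: "ns = as @ bs" "leaves u = map l as" "leaves v = map l bs"
    by (auto simp: append_eq_map_conv)
  from GO.IH(1)[OF *(2)] GO.IH(2)[OF *(3)]
  obtain u0 v0 where "leaves u0 = as" "map_gterm l u0 = u" "leaves v0 = bs" "map_gterm l v0 = v" by auto
  then show ?case using * by (intro exI[of _ "GO u0 v0"]) auto
qed

text \<open>Labelling the leaves by position reduces an arbitrary term to row products through the
  ordinary case at level 0; these are then sorted by \<open>tabl_in_span\<close>.\<close>

theorem Tab_spans:
  fixes p :: "'x::linorder \<Rightarrow> bool" and f :: "'x gterm \<Rightarrow> 'k::field"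
  assumes two: "(2 :: 'k) \<noteq> 0" and "fin_supp f"
  shows "f \<in> tspan p (Tab p)"
proof -
  have "(lc_single t :: 'x gterm \<Rightarrow> 'k) \<in> tspan p (Tab p)" for t
  proof -
    define N where "N = length (leaves t)"
    define l where "l = nth (leaves t)"
    have "leaves t = map l [0..<N]" by (simp add: l_def N_def map_nth)
    then obtain t0 where t0: "leaves t0 = [0..<N]" "map_gterm l t0 = t"
      using exists_labelling by blast
    define g where "g = (msgn (p \<circ> l) (mset [0..<N]) :: nat list \<Rightarrow> 'k)"
    have alt: "alternating (p \<circ> l) g"
      unfolding g_def by (rule alternating_msgn) (simp only: count_mset_distinct distinct_upt)
    moreover have "length v = N" if "g v \<noteq> 0" for v
      using msgn_length[OF that[unfolded g_def]] by simp
    ultimately have "lin (relab l g) (lc_single t0) \<in> tspan p (tabls N 0)"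
      by (intro relab_gspan gspan_all)
    then have "(\<lambda>s. g [0..<N] * lc_single t s) \<in> tspan p (tabls N 0)"
      by (simp add: relab_def t0)
    then have "(lc_single t :: 'x gterm \<Rightarrow> 'k) \<in> tspan p (tabls N 0)"
      by (rule subsp_smultD[OF subsp_tspan]) (simp add: g_def msgn_def invsgn_nonzero)
    then show ?thesis
      by (rule tspan_subset[rotated]) (auto simp: tabls_def intro: tabl_in_span[OF two])
  qed
  then have "lin lc_single f \<in> tspan p (Tab p)"
    by (intro lin_mem[OF subsp_tspan assms(2)])
  then show ?thesis using lin_id[OF assms(2)] by simp
qed


section \<open>The homomorphism\<close>

text \<open>The scalar carries the sign, so that the signs of successive exchanges multiply.\<close>

definition scong :: "('t \<Rightarrow> 'k::field) set \<Rightarrow> 'k \<Rightarrow> 't \<Rightarrow> 't \<Rightarrow> bool" where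
  "scong S c s t \<longleftrightarrow> lc_single s - (\<lambda>r. c * lc_single t r) \<in> S"

lemma scong_trans:
  assumes "subsp S" "scong S c s t" "scong S d t u"
  shows "scong S (c * d) s u"
proof -
  have eq: "lc_single s - (\<lambda>r. c * d * lc_single u r) =
    (lc_single s - (\<lambda>r. c * lc_single t r)) + (\<lambda>r. c * (lc_single t - (\<lambda>r. d * lc_single u r)) r)"
    by (simp add: fun_eq_iff fun_apps algebra_simps)
  show ?thesis
    unfolding scong_def eq
    by (intro subsp_add subsp_smult assms(1) assms(2,3)[unfolded scong_def])
qed

lemma scong_sym: "subsp S \<Longrightarrow> scong S 1 s t \<Longrightarrow> scong S 1 t s"
  unfolding scong_def by (simp add: subsp_diff_sym)

lemma scong_lmul:
  fixes c :: "'k::field"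
  assumes "scong (DS_ideal p) c s t"
  shows "scong (DS_ideal p) c (DM u s) (DM u t)"
  using DS_ideal.lmul[OF assms[unfolded scong_def], of u] by (simp add: scong_def)

lemma scong_rmul:
  fixes c :: "'k::field"
  assumes "scong (DS_ideal p) c s t"
  shows "scong (DS_ideal p) c (DM s u) (DM t u)"
  using DS_ideal.rmul[OF assms[unfolded scong_def], of u] by (simp add: scong_def)

lemma scong_assoc: "scong (DS_ideal p) 1 (DM (DM x y) z) (DM x (DM y z))"
  using DS_assoc[of x y z p] by (simp add: scong_def)

lemma scong_comm: "scong (DS_ideal p) (psign (dpar p x) (dpar p y)) (DM x y) (DM y x)"
  using DS_scomm[of x y p] by (simp add: scong_def)

lemma scong_left_comm:
  "scong (DS_ideal p) (psign (dpar p x) (dpar p y)) (DM x (DM y z)) (DM y (DM x z))"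
proof -
  note tr = scong_trans[OF subsp_DS_ideal]
  from tr[OF tr[OF scong_sym[OF subsp_DS_ideal scong_assoc] scong_rmul[OF scong_comm]] scong_assoc]
  show ?thesis by simp
qed

lemma scong_right_comm:
  "scong (DS_ideal p) (psign (dpar p y) (dpar p z)) (DM (DM x y) z) (DM (DM x z) y)"
proof -
  note tr = scong_trans[OF subsp_DS_ideal]
  from tr[OF tr[OF scong_assoc scong_lmul[OF scong_comm]] scong_sym[OF subsp_DS_ideal scong_assoc]]
  show ?thesis by simp
qed

lemma dpar_phi [simp]: "dpar p (phi t) = gpar p t"
  by (induction t) auto

text \<open>By the Leibniz rule \<open>x D(y Dz) = x Dy Dz + x y D(Dz)\<close>, and
  \<open>x Dy Dz\<close> is the image of \<open>(x \<circ> y) \<circ> z\<close> up to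
  associativity.\<close>

lemma phi_associator:
  "lc_single (phi (GO x (GO y z))) - lc_single (phi (GO (GO x y) z))
     - lc_single (DM (phi x) (DM (phi y) (DD (DD (phi z))))) \<in> (DS_ideal p :: ('x dterm \<Rightarrow> 'k::field) set)"
proof -
  let ?lc = "lc_single :: 'x dterm \<Rightarrow> 'x dterm \<Rightarrow> 'k"
  let ?x = "phi x" and ?y = "phi y" and ?z = "DD (phi z)"
  from DS_ideal.lmul[OF DS_leib, of ?x ?y ?z p]
  have "?lc (DM ?x (DD (DM ?y ?z))) - ?lc (DM ?x (DM (DD ?y) ?z)) - ?lc (DM ?x (DM ?y (DD ?z))) \<in> DS_ideal p"
    by simp
  from subsp_diff[OF subsp_DS_ideal this DS_assoc[of ?x "DD ?y" ?z p]]
  show ?thesis by (simp add: algebra_simps)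
qed

text \<open>Left supersymmetry holds because the image of the associator is supersymmetric, right
  supercommutativity because \<open>Dy\<close> and \<open>Dz\<close> supercommute. Left
  multiplication in the GDN algebra differentiates its right factor, so closure of
  \<open>DS_ideal\<close> under \<open>DD\<close> is used.\<close>

lemma phi_ideal:
  fixes f :: "'x gterm \<Rightarrow> 'k::field"
  assumes "f \<in> GDN_ideal p"
  shows "phi_lin f \<in> DS_ideal p"
  using assms
proof (induction rule: GDN_ideal.induct)
  case (lsym x y z)
  let ?lc = "lc_single :: 'x dterm \<Rightarrow> 'x dterm \<Rightarrow> 'k"
  define s where "s = (psign (gpar p x) (gpar p y) :: 'k)"
  define a where "a x y = ?lc (phi (GO x (GO y z))) - ?lc (phi (GO (GO x y) z))" for x y
  define b where "b x y = ?lc (DM (phi x) (DM (phi y) (DD (DD (phi z)))))" for x y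
  have 1: "a x y - b x y \<in> DS_ideal p" for x y
    unfolding a_def b_def by (rule phi_associator)
  have 2: "b x y - (\<lambda>t. s * b y x t) \<in> DS_ideal p"
    unfolding b_def s_def scong_def[symmetric] dpar_phi[symmetric] by (rule scong_left_comm)
  have "a x y - (\<lambda>t. s * a y x t) = ((a x y - b x y) + (b x y - (\<lambda>t. s * b y x t)))
      - (\<lambda>t. s * (a y x - b y x) t)"
    by (simp add: fun_eq_iff fun_apps algebra_simps)
  also have "\<dots> \<in> DS_ideal p"
    by (intro subsp_diff subsp_add subsp_smult subsp_DS_ideal 1 2)
  finally have "phi_lin ((lc_single (GO x (GO y z)) - lc_single (GO (GO x y) z))
    - (\<lambda>t. s * (lc_single (GO y (GO x z)) - lc_single (GO (GO y x) z)) t)) \<in> DS_ideal p"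
    by (simp add: phi_lin_def a_def)
  then show ?case by (simp only: fun_diff_def s_def)
next
  case (rcom x y z)
  have "scong (DS_ideal p :: ('x dterm \<Rightarrow> 'k) set) (psign (gpar p y) (gpar p z))
      (phi (GO (GO x y) z)) (phi (GO (GO x z) y))"
    using scong_right_comm[of p "DD (phi y)" "DD (phi z)" "phi x"] by simp
  then have "phi_lin (lc_single (GO (GO x y) z)
     - (\<lambda>t. psign (gpar p y) (gpar p z) * lc_single (GO (GO x z) y) t)) \<in> (DS_ideal p :: ('x dterm \<Rightarrow> 'k) set)"
    by (simp add: phi_lin_def scong_def)
  then show ?case by (simp only: fun_diff_def)
next
  case zero
  then show ?case by (simp add: phi_lin_def subsp_0[OF subsp_DS_ideal] flip: zero_fun_def)
next
  case (add f1 f2)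
  then have "phi_lin (f1 + f2) \<in> DS_ideal p"
    by (simp add: phi_lin_def GDN_ideal_fin_supp subsp_add[OF subsp_DS_ideal])
  then show ?case by (simp add: plus_fun_def)
next
  case (smult f c)
  then show ?case by (simp add: phi_lin_def GDN_ideal_fin_supp subsp_smult[OF subsp_DS_ideal])
next
  case (lmul f u)
  from DS_ideal.lmul[OF DS_ideal.der[OF lmul.IH], of "phi u"] GDN_ideal_fin_supp[OF lmul.hyps]
  show ?case by (simp add: phi_lin_def lin_lin)
next
  case (rmul f u)
  from DS_ideal.rmul[OF rmul.IH, of "DD (phi u)"] GDN_ideal_fin_supp[OF rmul.hyps]
  show ?case by (simp add: phi_lin_def lin_lin)
qed

section \<open>Evaluation of differential terms\<close>

text \<open>The letter \<open>(a, n)\<close> stands for the \<open>n\<close>-th derivative of \<open>a\<close>. Expanding a differential term by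
  the Leibniz rule gives a sum of words; \<open>ev t g\<close> is the sum of the values of \<open>g\<close> on them.\<close>

fun der :: "(('x \<times> nat) list \<Rightarrow> 'k::comm_ring_1) \<Rightarrow> ('x \<times> nat) list \<Rightarrow> 'k" where
  "der g [] = 0"
| "der g (x # w) = g ((fst x, Suc (snd x)) # w) + der (\<lambda>v. g (x # v)) w"

fun ev :: "'x dterm \<Rightarrow> (('x \<times> nat) list \<Rightarrow> 'k::comm_ring_1) \<Rightarrow> 'k" where
  "ev (DV a) g = g [(a, 0)]"
| "ev (DM u v) g = ev u (\<lambda>x. ev v (\<lambda>y. g (x @ y)))"
| "ev (DD u) g = ev u (der g)"

lemma der_append: "der g (u @ v) = der (\<lambda>x. g (x @ v)) u + der (\<lambda>y. g (u @ y)) v"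
  by (induction u arbitrary: g) auto

lemma der_add: "der (\<lambda>w. g w + h w) w = der g w + der h w"
  by (induction w arbitrary: g h) auto

lemma der_smult: "der (\<lambda>w. c * g w) w = c * der g w"
  by (induction w arbitrary: g) (auto simp: distrib_left)

lemma ev_add: "ev t (\<lambda>w. g w + h w) = ev t g + ev t h"
proof (induction t arbitrary: g h)
  case (DD t)
  have "der (\<lambda>w. g w + h w) = (\<lambda>w. der g w + der h w)" by (simp add: fun_eq_iff der_add)
  then show ?case by (simp add: DD)
qed simp_all

lemma ev_smult: "ev t (\<lambda>w. c * g w) = c * ev t g"
proof (induction t arbitrary: g)
  case (DD t)
  have "der (\<lambda>w. c * g w) = (\<lambda>w. c * der g w)" by (simp add: fun_eq_iff der_smult)
  then show ?case by (simp add: DD)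
qed simp_all

lemma ev_zero: "ev t (\<lambda>w. 0) = 0"
  using ev_smult[of t 0 "\<lambda>_. 0"] by simp

lemma ev_sum:
  assumes "finite A"
  shows "ev t (\<lambda>w. \<Sum>s\<in>A. c s * h s w) = (\<Sum>s\<in>A. c s * ev t (h s))"
  using assms by (induction A rule: finite_induct) (simp_all add: ev_zero ev_add ev_smult)

lemma der_ev: "der (\<lambda>x. ev v (g x)) w = ev v (\<lambda>y. der (\<lambda>x. g x y) w)"
  by (induction w arbitrary: g) (simp_all add: ev_zero ev_add)

text \<open>Both sides are the same finite double sum over the words of \<open>u\<close> and of
  \<open>v\<close>.\<close>

lemma ev_swap: "ev u (\<lambda>x. ev v (g x)) = ev v (\<lambda>y. ev u (\<lambda>x. g x y))"
proof (induction u arbitrary: g)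
  case (DM u1 u2)
  have "ev (DM u1 u2) (\<lambda>x. ev v (g x)) = ev u1 (\<lambda>a. ev v (\<lambda>y. ev u2 (\<lambda>b. g (a @ b) y)))"
    by (simp add: DM(2))
  then show ?case by (simp add: DM(1)[of "\<lambda>a y. ev u2 (\<lambda>b. g (a @ b) y)"])
next
  case (DD u)
  have "der (\<lambda>x. ev v (g x)) = (\<lambda>w. ev v (\<lambda>y. der (\<lambda>x. g x y) w))"
    by (simp add: fun_eq_iff der_ev)
  then show ?case by (simp add: DD)
qed simp

lemma der_cong_par:
  assumes "\<And>v. lpar (p \<circ> fst) v = lpar (p \<circ> fst) w \<Longrightarrow> g v = h v"
  shows "der g w = der h w"
  using assms
proof (induction w arbitrary: g h)
  case (Cons x w)
  have "g ((fst x, Suc (snd x)) # w) = h ((fst x, Suc (snd x)) # w)"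
    by (rule Cons.prems) simp
  moreover have "der (\<lambda>v. g (x # v)) w = der (\<lambda>v. h (x # v)) w"
    by (rule Cons.IH, rule Cons.prems) simp
  ultimately show ?case by simp
qed simp

text \<open>Derivation keeps parity, so only words of parity \<open>dpar p t\<close> occur in the
  expansion. This turns the parities of terms in the commutation rule into parities of
  words.\<close>

lemma ev_cong_par:
  assumes "\<And>w. lpar (p \<circ> fst) w = dpar p t \<Longrightarrow> g w = h w"
  shows "ev t g = ev t h"
  using assms
proof (induction t arbitrary: g h)
  case (DM u v)
  show ?case unfolding ev.simps
    by (rule DM.IH(1), rule DM.IH(2), rule DM.prems) simp
next
  case (DD t)
  show ?case unfolding ev.simps
    by (rule DD.IH, rule der_cong_par[of p], rule DD.prems) (simp only: dpar.simps)
next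
  case (DV a)
  have "g [(a, 0)] = h [(a, 0)]" by (rule DV) simp
  then show ?case by simp
qed

text \<open>Deriving a letter changes only its second component, while the sign depends on the
  first.\<close>

lemma alternating_der:
  assumes "alternating (p \<circ> fst) g"
  shows "alternating (p \<circ> fst) (der g)"
  unfolding alternating_def
proof (intro allI)
  fix us vs and x y :: "'a \<times> nat"
  let ?c = "psign ((p \<circ> fst) x) ((p \<circ> fst) y) :: 'b"
  note D = alternatingD[OF assms]
  have 1: "(\<lambda>u. g (u @ x # y # vs)) = (\<lambda>u. ?c * g (u @ y # x # vs))" by (rule ext) (rule D)
  have 2: "(\<lambda>v. g (us @ x # y # v)) = (\<lambda>v. ?c * g (us @ y # x # v))" by (rule ext) (rule D)
  have 3: "g (us @ (fst x, Suc (snd x)) # y # vs) = ?c * g (us @ y # (fst x, Suc (snd x)) # vs)"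
    using D[of us "(fst x, Suc (snd x))" y vs] by (simp only: o_apply fst_conv)
  have 4: "g (us @ x # (fst y, Suc (snd y)) # vs) = ?c * g (us @ (fst y, Suc (snd y)) # x # vs)"
    using D[of us x "(fst y, Suc (snd y))" vs] by (simp only: o_apply fst_conv)
  show "der g (us @ x # y # vs) = ?c * der g (us @ y # x # vs)"
    unfolding der_append der.simps 1 2 3 4 der_smult by (simp only: distrib_left add_ac)
qed

text \<open>Multiplying or deriving an element of the ideal replaces \<open>g\<close> by another
  alternating functional, so all of them are treated at once. Scalars appear as functions on
  \<open>unit\<close> because \<open>lin\<close> produces functions.\<close>

lemma ev_ideal:
  fixes f :: "'x dterm \<Rightarrow> 'k::field"
  assumes "f \<in> DS_ideal p" "alternating (p \<circ> fst) g"
  shows "lin (\<lambda>t (_ :: unit). ev t g) f = 0"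
  using assms
proof (induction arbitrary: g rule: DS_ideal.induct)
  case (assoc x y z)
  have "lin (\<lambda>t (_ :: unit). ev t g) (lc_single (DM (DM x y) z) - lc_single (DM x (DM y z))) = 0"
    by simp
  then show ?case by (simp only: fun_diff_def)
next
  case (scomm x y)
  let ?s = "psign (dpar p x) (dpar p y) :: 'k"
  have "ev (DM x y) g = ev x (\<lambda>u. ev y (\<lambda>v. ?s * g (v @ u)))"
    unfolding ev.simps
  proof (intro ev_cong_par[of p])
    fix u v :: "('x \<times> nat) list"
    assume "lpar (p \<circ> fst) u = dpar p x" "lpar (p \<circ> fst) v = dpar p y"
    then show "g (u @ v) = ?s * g (v @ u)"
      using alternating_block[OF scomm, of "[]" u v "[]"] by (simp only: append_Nil append_Nil2)
  qed
  also have "\<dots> = ?s * ev (DM y x) g"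
    by (simp add: ev_smult ev_swap[of x y])
  finally have "lin (\<lambda>t (_ :: unit). ev t g) (lc_single (DM x y) - (\<lambda>t. ?s * lc_single (DM y x) t)) = 0"
    by (simp only: lin_diff lin_smult lin_single fin_supp_single fin_supp_smult diff_self)
  then show ?case by (simp only: fun_diff_def)
next
  case (leib x y)
  have "der (\<lambda>u. ev y (\<lambda>v. g (u @ v))) u = ev y (\<lambda>v. der (\<lambda>a. g (a @ v)) u)" for u
    by (rule der_ev)
  then have "der (\<lambda>u. ev y (\<lambda>v. g (u @ v))) = (\<lambda>u. ev y (\<lambda>v. der (\<lambda>a. g (a @ v)) u))"
    by (rule ext)
  then have "ev (DD (DM x y)) g = ev (DM (DD x) y) g + ev (DM x (DD y)) g"
    by (simp add: der_append ev_add)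
  then have "lin (\<lambda>t (_ :: unit). ev t g)
     (lc_single (DD (DM x y)) - lc_single (DM (DD x) y) - lc_single (DM x (DD y))) = 0"
    by (simp only: lin_diff lin_single fin_supp_single fin_supp_diff) (simp add: fun_eq_iff fun_apps)
  then show ?case by (simp only: fun_diff_def)
next
  case zero
  then show ?case by (simp flip: zero_fun_def)
next
  case (add f1 f2)
  then have "lin (\<lambda>t (_ :: unit). ev t g) (f1 + f2) = 0"
    by (simp add: DS_ideal_fin_supp)
  then show ?case by (simp add: plus_fun_def)
next
  case (smult f c)
  then show ?case by (simp add: DS_ideal_fin_supp) (simp add: zero_fun_def)
next
  case (lmul f u)
  have fin: "finite {s. f s \<noteq> 0}" using DS_ideal_fin_supp[OF lmul.hyps] by (simp add: fin_supp_def)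
  have "alternating (p \<circ> fst) (\<lambda>y. g (x @ y))" for x
    using alternating_context[OF lmul.prems, of x "[]"] by (simp only: append_Nil2)
  then have "lin (\<lambda>t (_ :: unit). ev t (\<lambda>y. g (x @ y))) f = 0" for x by (rule lmul.IH)
  then have "(\<Sum>s\<in>{s. f s \<noteq> 0}. f s * ev s (\<lambda>y. g (x @ y))) = 0" for x
    by (simp add: lin_def fun_eq_iff fun_apps)
  then have "(\<Sum>s\<in>{s. f s \<noteq> 0}. f s * ev u (\<lambda>x. ev s (\<lambda>y. g (x @ y)))) = 0"
    by (simp add: ev_zero flip: ev_sum[OF fin])
  then show ?case using DS_ideal_fin_supp[OF lmul.hyps]
    by (simp add: lin_lin) (simp add: lin_def fun_eq_iff fun_apps)
next
  case (rmul f u)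
  have fin: "finite {s. f s \<noteq> 0}" using DS_ideal_fin_supp[OF rmul.hyps] by (simp add: fin_supp_def)
  have "alternating (p \<circ> fst) (\<lambda>x. g (x @ y))" for y
    using alternating_context[OF rmul.prems, of "[]" y] by (simp only: append_Nil)
  then have "lin (\<lambda>t (_ :: unit). ev t (\<lambda>x. g (x @ y))) f = 0" for y by (rule rmul.IH)
  then have "(\<Sum>s\<in>{s. f s \<noteq> 0}. f s * ev s (\<lambda>x. g (x @ y))) = 0" for y
    by (simp add: lin_def fun_eq_iff fun_apps)
  then have "(\<Sum>s\<in>{s. f s \<noteq> 0}. f s * ev u (\<lambda>y. ev s (\<lambda>x. g (x @ y)))) = 0"
    by (simp add: ev_zero flip: ev_sum[OF fin])
  then have "(\<Sum>s\<in>{s. f s \<noteq> 0}. f s * ev (DM s u) g) = 0"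
    unfolding ev.simps ev_swap[of _ u] .
  then show ?case using DS_ideal_fin_supp[OF rmul.hyps]
    by (simp add: lin_lin) (simp add: lin_def fun_eq_iff fun_apps)
next
  case (der f)
  from der.IH[OF alternating_der[OF der.prems]] DS_ideal_fin_supp[OF der.hyps]
  show ?case by (simp add: lin_lin)
qed

section \<open>Tableaux are independent\<close>

text \<open>The number of derived letters, the counterpart of the number of rows; derivation never
  lowers it.\<close>

definition npos :: "('x \<times> nat) list \<Rightarrow> nat" where
  "npos w = length (filter (\<lambda>x. snd x > 0) w)"

lemma npos_simps [simp]:
  "npos [] = 0" "npos (x # w) = (if snd x > 0 then 1 else 0) + npos w" "npos (u @ v) = npos u + npos v"
  by (auto simp: npos_def)

lemma npos_mset: "mset u = mset v \<Longrightarrow> npos u = npos v"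
  unfolding npos_def by (metis mset_filter size_mset)

lemma der_eq_0:
  assumes "\<And>v. npos v \<ge> npos w \<Longrightarrow> g v = 0"
  shows "der g w = 0"
  using assms by (induction w arbitrary: g) auto

lemma der_cong_pos:
  assumes "\<And>v. npos v \<ge> 1 \<Longrightarrow> g v = h v"
  shows "der g w = der h w"
  using assms
proof (induction w arbitrary: g h)
  case (Cons x w)
  have "g ((fst x, Suc (snd x)) # w) = h ((fst x, Suc (snd x)) # w)"
    by (rule Cons.prems) simp
  moreover have "der (\<lambda>v. g (x # v)) w = der (\<lambda>v. h (x # v)) w"
    by (rule Cons.IH, rule Cons.prems) simp
  ultimately show ?case by simp
qed simp

definition lead :: "'x list \<Rightarrow> ('x \<times> nat) list" where
  "lead l = map (\<lambda>x. (x, 0)) (butlast l) @ [foot l]"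

definition lead_tab :: "'x \<Rightarrow> 'x list list \<Rightarrow> ('x \<times> nat) list" where
  "lead_tab a ls = (a, 0) # concat (map lead ls)"

lemma npos_map_0 [simp]: "npos (map (\<lambda>x. (x, 0)) u) = 0"
  by (simp add: npos_def)

lemma npos_lead [simp]: "l \<noteq> [] \<Longrightarrow> npos (lead l) = 1"
  by (simp add: lead_def foot_def)

text \<open>Deriving any letter of \<open>u\<close> yields a second derived letter, which
  \<open>g\<close> ignores; only the last letter is left to be derived again.\<close>

lemma der_lead:
  assumes "n > 0" "\<And>w. npos w > 1 \<Longrightarrow> g w = 0"
  shows "der g (map (\<lambda>x. (x, 0)) u @ [(c, n)]) = g (map (\<lambda>x. (x, 0)) u @ [(c, Suc n)])"
  using assms(2)
proof (induction u arbitrary: g)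
  case (Cons b u)
  have "g ((b, 1) # map (\<lambda>x. (x, 0)) u @ [(c, n)]) = 0"
    by (rule Cons.prems) (use assms(1) in simp)
  moreover have "der (\<lambda>v. g ((b, 0) # v)) (map (\<lambda>x. (x, 0)) u @ [(c, n)]) =
      g ((b, 0) # map (\<lambda>x. (x, 0)) u @ [(c, Suc n)])"
    by (rule Cons.IH) (simp add: Cons.prems)
  ultimately show ?case by simp
qed simp

text \<open>In \<open>D(b Dw) = Db Dw + b D(Dw)\<close> the first summand has two derived letters
  and is ignored by \<open>g\<close>; the second derives the foot once more.\<close>

lemma ev_row:
  assumes "l \<noteq> []" "\<And>w. npos w > 1 \<Longrightarrow> g w = 0"
  shows "ev (DD (phi (rcomb l))) g = g (lead l)"
  using assms
proof (induction l arbitrary: g rule: list_nonempty_induct)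
  case (single b)
  then show ?case by (simp add: lead_def foot_def)
next
  case (cons b l)
  \<comment> \<open>\<open>h\<close> collects both summands of the Leibniz rule for the first letter
    \<open>b\<close>; it inherits the vanishing condition, as the induction hypothesis
    requires.\<close>
  define h where "h y = g ((b, 1) # y) + der (\<lambda>v. g ((b, 0) # v)) y" for y
  have h0: "h y = 0" if "npos y > 1" for y
    using that der_eq_0[of y "\<lambda>v. g ((b, 0) # v)"] cons.prems by (simp add: h_def)
  have "ev (DD (phi (rcomb (b # l)))) g = ev (DD (phi (rcomb l))) h"
    using cons.hyps by (simp add: h_def[abs_def])
  also have "\<dots> = h (lead l)" by (rule cons.IH) (rule h0)
  also have "g ((b, 1) # lead l) = 0"
    by (rule cons.prems) (use cons.hyps in simp)
  then have "h (lead l) = der (\<lambda>v. g ((b, 0) # v)) (lead l)" by (simp add: h_def)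
  also have "\<dots> = g ((b, 0) # map (\<lambda>x. (x, 0)) (butlast l) @ [(last l, Suc (length l))])"
    unfolding lead_def foot_def using cons.hyps by (intro der_lead) (auto intro: cons.prems)
  also have "\<dots> = g (lead (b # l))" using cons.hyps by (simp add: lead_def foot_def)
  finally show ?case .
qed

lemma phi_tabl_snoc: "phi (tabl a (ls @ [l])) = DM (phi (tabl a ls)) (DD (phi (rcomb l)))"
  by simp

text \<open>Every row sits under a \<open>DD\<close>, so each word of the expansion has at least as
  many derived letters as there are rows.\<close>

lemma ev_tab_cong:
  assumes "\<And>w. npos w \<ge> length ls \<Longrightarrow> g w = h w"
  shows "ev (phi (tabl a ls)) g = ev (phi (tabl a ls)) h"
  using assms
proof (induction ls arbitrary: g h rule: rev_induct)
  case (snoc l ls)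
  have "ev (phi (rcomb l)) (der (\<lambda>y. g (x @ y))) = ev (phi (rcomb l)) (der (\<lambda>y. h (x @ y)))"
    if "npos x \<ge> length ls" for x
  proof -
    have "der (\<lambda>y. g (x @ y)) = der (\<lambda>y. h (x @ y))"
      using that by (intro ext der_cong_pos snoc.prems) simp
    then show ?thesis by simp
  qed
  then show ?case unfolding phi_tabl_snoc ev.simps by (rule snoc.IH)
qed simp

text \<open>Since \<open>g\<close> vanishes beyond that minimum, each row may contribute one derived
  letter only, which leaves its leading word.\<close>

lemma ev_tab:
  assumes "[] \<notin> set ls" "\<And>w. npos w > length ls \<Longrightarrow> g w = 0"
  shows "ev (phi (tabl a ls)) g = g (lead_tab a ls)"
  using assms
proof (induction ls arbitrary: g rule: rev_induct)
  case (snoc l ls)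
  have "ev (phi (tabl a (ls @ [l]))) g = ev (phi (tabl a ls)) (\<lambda>x. ev (DD (phi (rcomb l))) (\<lambda>y. g (x @ y)))"
    unfolding phi_tabl_snoc ev.simps ..
  also have "\<dots> = ev (phi (tabl a ls)) (\<lambda>x. g (x @ lead l))"
    using snoc.prems by (intro ev_tab_cong ev_row) auto
  also have "\<dots> = g (lead_tab a ls @ lead l)"
    using snoc.prems by (intro snoc.IH) auto
  finally show ?case by (simp add: lead_tab_def)
qed (simp add: lead_tab_def)

lemma mset_lead_tab:
  "mset (lead_tab a ls) = image_mset (\<lambda>x. (x, 0)) (mset (tab_chain a ls)) + mset (map foot ls)"
  unfolding lead_tab_def tab_chain_def by (induction ls) (auto simp: lead_def)

lemma npos_lead_tab: "[] \<notin> set ls \<Longrightarrow> npos (lead_tab a ls) = length ls"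
  unfolding lead_tab_def by (induction ls) auto

section \<open>Recovering a tableau from its leading monomial\<close>

lemma count_sorted_wrt:
  assumes "sorted_wrt R xs" "\<not> R y y"
  shows "count (mset xs) y \<le> 1"
  using assms(1)
proof (induction xs)
  case (Cons x xs)
  then show ?case using assms(2) by (cases "x = y") (auto simp: count_eq_zero_iff)
qed simp

lemma sorted_wrt_unique:
  assumes "sorted_wrt R xs" "sorted_wrt R ys" "mset xs = mset ys"
    "\<And>x y. R x y \<Longrightarrow> R y x \<Longrightarrow> x = y"
  shows "xs = ys"
  using assms(1-3)
proof (induction xs arbitrary: ys)
  case (Cons x xs)
  then obtain y ys' where ys: "ys = y # ys'" by (cases ys) auto
  have "x = y"
  proof (rule ccontr)
    assume "x \<noteq> y"
    then have "x \<in> set ys'" "y \<in> set xs"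
      using Cons.prems(3) ys by (metis list.set_intros(1) set_ConsD set_mset_mset)+
    then show False using Cons.prems ys assms(4) \<open>x \<noteq> y\<close> by auto
  qed
  then show ?case using Cons ys by auto
qed simp

lemma rows_unique:
  assumes "map foot ls = map foot ms" "concat (map butlast ls) = concat (map butlast ms)"
    "[] \<notin> set ls" "[] \<notin> set ms"
  shows "ls = ms"
  using assms
proof (induction ls arbitrary: ms)
  case (Cons l ls)
  then obtain m ms' where ms: "ms = m # ms'" by (cases ms) auto
  have len: "length l = length m" "last l = last m" using Cons.prems(1) ms by (auto simp: foot_def)
  then have "butlast l = butlast m" "concat (map butlast ls) = concat (map butlast ms')"
    using Cons.prems(2) ms by auto
  moreover have "l \<noteq> []" "m \<noteq> []" using Cons.prems ms by auto
  ultimately have "l = m" using len by (metis append_butlast_last_id)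
  moreover have "ls = ms'"
    by (rule Cons.IH) (use Cons.prems ms \<open>concat (map butlast ls) = _\<close> in auto)
  ultimately show ?case by (simp add: ms)
qed simp

lemma foot_pos: "[] \<notin> set ls \<Longrightarrow> (b, h) \<in> set (map foot ls) \<Longrightarrow> h > 0"
  by (auto simp: foot_def)

text \<open>Underived letters come from the chain and derived ones from the feet; both orders are
  strict at odd letters. Hence the sign functional of the leading word is alternating.\<close>

lemma count_lead_tab:
  assumes "is_tab p a ls" "p (fst y)"
  shows "count (mset (lead_tab a ls)) y \<le> 1"
proof -
  obtain x n where y: "y = (x, n)" by force
  note tab = assms(1)[unfolded is_tab_iff]
  show ?thesis
  proof (cases "n = 0")
    case True
    have "y \<notin> set (map foot ls)" using foot_pos[of ls x n] tab y True by auto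
    then have "count (mset (map foot ls)) y = 0" by (metis count_mset_0_iff)
    moreover have "count (image_mset (\<lambda>x. (x, 0 :: nat)) A) (x, 0) = count A x" for A
      by (induction A) auto
    moreover have "count (mset (tab_chain a ls)) x \<le> 1"
      using tab assms(2) y by (intro count_sorted_wrt[of _ _ x]) auto
    ultimately show ?thesis by (simp add: mset_lead_tab y True)
  next
    case False
    then have "count (image_mset (\<lambda>x. (x, 0 :: nat)) (mset (tab_chain a ls))) y = 0"
      unfolding count_eq_zero_iff by (auto simp: y)
    moreover have "count (mset (map foot ls)) y \<le> 1"
      using tab assms(2) y by (intro count_sorted_wrt[of _ _ y]) auto
    ultimately show ?thesis by (simp add: mset_lead_tab)
  qed
qed

text \<open>Rows are nonempty, so feet have positive height: the underived letters give the chain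
  and the derived ones the feet, as multisets. Being sorted, both lists are determined, and the
  heights tell where to cut the chain.\<close>

lemma lead_tab_inj:
  assumes "is_tab p a ls" "is_tab p b ms" "mset (lead_tab a ls) = mset (lead_tab b ms)"
  shows "a = b \<and> ls = ms"
proof -
  note tab = assms(1,2)[unfolded is_tab_iff]
  have chain: "image_mset fst {#y \<in># mset (lead_tab c ks). snd y = 0#} = mset (tab_chain c ks)"
    and foot: "{#y \<in># mset (lead_tab c ks). snd y > 0#} = mset (map foot ks)"
    if "[] \<notin> set ks" for c :: 'a and ks
  proof -
    have pos: "snd y > 0" if "y \<in># mset (map foot ks)" for y
      using foot_pos[OF \<open>[] \<notin> set ks\<close>, of "fst y" "snd y"] that by simp
    have "{#y \<in># mset (map foot ks). snd y = 0#} = {#y \<in># mset (map foot ks). False#}"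
      "{#y \<in># mset (map foot ks). snd y > 0#} = {#y \<in># mset (map foot ks). True#}"
      by (rule filter_mset_cong[OF refl], use pos in fastforce)+
    then have 1: "{#y \<in># mset (map foot ks). snd y = 0#} = {#}"
      "{#y \<in># mset (map foot ks). snd y > 0#} = mset (map foot ks)"
      by simp_all
    have 2: "{#y \<in># image_mset (\<lambda>x. (x, 0 :: nat)) A. snd y = 0#} = image_mset (\<lambda>x. (x, 0)) A"
      "{#y \<in># image_mset (\<lambda>x. (x, 0 :: nat)) A. snd y > 0#} = {#}" for A :: "'a multiset"
      by (induction A) auto
    show "image_mset fst {#y \<in># mset (lead_tab c ks). snd y = 0#} = mset (tab_chain c ks)"
      unfolding mset_lead_tab filter_union_mset 1 2 by (simp add: multiset.map_comp comp_def)
    show "{#y \<in># mset (lead_tab c ks). snd y > 0#} = mset (map foot ks)"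
      unfolding mset_lead_tab filter_union_mset 1 2 by simp
  qed
  have "mset (tab_chain a ls) = mset (tab_chain b ms)"
    using chain[of ls a] chain[of ms b] tab assms(3) by simp
  then have 1: "tab_chain a ls = tab_chain b ms"
    using tab by (intro sorted_wrt_unique[of "\<lambda>x y. y < x \<or> y = x \<and> \<not> p x"]) auto
  have "mset (map foot ls) = mset (map foot ms)"
    using foot[of ls a] foot[of ms b] tab assms(3) by simp
  then have "map foot ls = map foot ms"
    using tab by (intro sorted_wrt_unique[of "\<lambda>(b, h) (b', h'). h' < h \<or> h' = h \<and> (b' < b \<or> b' = b \<and> \<not> p b)"]) auto
  then show ?thesis
    using 1 tab rows_unique[of ls ms] by (auto simp: tab_chain_def)
qed

theorem Tab_independent:
  fixes p :: "'x::linorder \<Rightarrow> bool" and g :: "'x gterm \<Rightarrow> 'k::field"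
  assumes "fin_supp g" "{t. g t \<noteq> 0} \<subseteq> Tab p" "phi_lin g \<in> DS_ideal p"
  shows "g = 0"
proof (rule ccontr)
  assume "g \<noteq> 0"
  then obtain t0 where t0: "g t0 \<noteq> 0" by (auto simp: fun_eq_iff fun_apps)
  have "\<forall>s\<in>Tab p. \<exists>r. s = tabl (fst r) (snd r) \<and> is_tab p (fst r) (snd r)"
    by (fastforce simp: Tab_def)
  \<comment> \<open>A presentation by head and rows is chosen for each tableau, since
    \<open>Tab\<close> contains only the terms.\<close>
  then obtain r where r: "\<And>s. s \<in> Tab p \<Longrightarrow> s = tabl (fst (r s)) (snd (r s)) \<and> is_tab p (fst (r s)) (snd (r s))"
    by metis
  \<comment> \<open>With the fewest rows at \<open>t\<close>, the functional \<open>G\<close>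
    vanishes on every word with more derived letters than the rows of any tableau in the support, so
    \<open>ev_tab\<close> applies to all of them.\<close>
  obtain t where t: "g t \<noteq> 0" "\<And>s. g s \<noteq> 0 \<Longrightarrow> length (snd (r t)) \<le> length (snd (r s))"
    using ex_has_least_nat[of "\<lambda>s. g s \<noteq> 0" t0 "\<lambda>s. length (snd (r s))"] t0 by blast
  let ?lead = "\<lambda>s. lead_tab (fst (r s)) (snd (r s))"
  define G where "G = (msgn (p \<circ> fst) (mset (?lead t)) :: ('x \<times> nat) list \<Rightarrow> 'k)"
  have tab: "is_tab p (fst (r s)) (snd (r s))" "s = tabl (fst (r s)) (snd (r s))" if "g s \<noteq> 0" for s
    using that assms(2) r[of s] by auto
  have ne: "[] \<notin> set (snd (r s))" if "g s \<noteq> 0" for s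
    using tab(1)[OF that] by (simp add: is_tab_iff)
  have alt: "alternating (p \<circ> fst) G"
    unfolding G_def by (rule alternating_msgn) (rule count_lead_tab[OF tab(1)[OF t(1)]], simp)
  have G0: "G w = 0" if "npos w > length (snd (r t))" for w
  proof -
    have "mset w \<noteq> mset (?lead t)"
      using that npos_mset[of w "?lead t"] npos_lead_tab[OF ne[OF t(1)]] by auto
    then show ?thesis by (simp add: G_def msgn_def)
  qed
  have ev: "ev (phi s) G = (if s = t then G (?lead t) else 0)" if s: "g s \<noteq> 0" for s
  proof -
    have "ev (phi (tabl (fst (r s)) (snd (r s)))) G = G (?lead s)"
      by (rule ev_tab[OF ne[OF s]], rule G0) (use t(2)[OF s] in simp)
    then have 1: "ev (phi s) G = G (?lead s)" using tab(2)[OF s] by simp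
    have "G (?lead s) = 0" if "s \<noteq> t"
    proof -
      have "mset (?lead s) \<noteq> mset (?lead t)"
        using lead_tab_inj[OF tab(1)[OF s] tab(1)[OF t(1)]] tab(2)[OF s] tab(2)[OF t(1)] that by auto
      then show ?thesis by (simp add: G_def msgn_def)
    qed
    then show ?thesis using 1 by simp
  qed
  have "lin (\<lambda>d (_ :: unit). ev d G) (phi_lin g) = 0"
    using assms(3) alt by (rule ev_ideal)
  then have "(\<Sum>s\<in>{s. g s \<noteq> 0}. g s * ev (phi s) G) = 0"
    using assms(1) by (simp add: phi_lin_def lin_lin) (simp add: lin_def fun_eq_iff fun_apps)
  also have "(\<Sum>s\<in>{s. g s \<noteq> 0}. g s * ev (phi s) G) = (\<Sum>s\<in>{s. g s \<noteq> 0}. if s = t then g t * G (?lead t) else 0)"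
    by (rule sum.cong) (auto simp: ev)
  also have "\<dots> = g t * G (?lead t)"
    using assms(1) t(1) by (simp add: fin_supp_def)
  finally show False using t(1) invsgn_nonzero by (auto simp: G_def msgn_def)
qed

theorem theorem3p4:
  fixes p :: "'x::wellorder \<Rightarrow> bool"
  assumes char: "(2::'k::field) \<noteq> 0"
  shows "(\<forall>f :: 'x gterm \<Rightarrow> 'k. fin_supp f \<longrightarrow>
            (\<exists>g. fin_supp g \<and> {t. g t \<noteq> 0} \<subseteq> Tab p
                 \<and> (\<lambda>t. f t - g t) \<in> GDN_ideal p))
       \<and> (\<forall>g :: 'x gterm \<Rightarrow> 'k. fin_supp g \<and> {t. g t \<noteq> 0} \<subseteq> Tab p
                 \<and> g \<in> GDN_ideal p \<longrightarrow> g = (\<lambda>t. 0))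
       \<and> (\<forall>f :: 'x gterm \<Rightarrow> 'k. f \<in> GDN_ideal p \<longrightarrow> phi_lin f \<in> DS_ideal p)
       \<and> (\<forall>f :: 'x gterm \<Rightarrow> 'k. fin_supp f \<longrightarrow> phi_lin f \<in> DS_ideal p
                 \<longrightarrow> f \<in> GDN_ideal p)"
proof (intro conjI allI impI)
  have span: "\<exists>g. fin_supp g \<and> {t. g t \<noteq> 0} \<subseteq> Tab p \<and> f - g \<in> GDN_ideal p"
    if "fin_supp f" for f :: "'x gterm \<Rightarrow> 'k"
    using tspan_repr[OF Tab_spans[OF char that, of p]] by metis
  fix f :: "'x gterm \<Rightarrow> 'k"
  show "\<exists>g. fin_supp g \<and> {t. g t \<noteq> 0} \<subseteq> Tab p \<and> (\<lambda>t. f t - g t) \<in> GDN_ideal p"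
    if "fin_supp f"
    using span[OF that] by (simp only: fun_diff_def)
  \<comment> \<open>A relation among tableaux is carried to one among their images, which are
    independent.\<close>
  show "f = (\<lambda>t. 0)" if "fin_supp f \<and> {t. f t \<noteq> 0} \<subseteq> Tab p \<and> f \<in> GDN_ideal p"
    using Tab_independent[of f p] phi_ideal[of f p] that by (simp add: zero_fun_def)
  show "phi_lin f \<in> DS_ideal p" if "f \<in> GDN_ideal p"
    using that by (rule phi_ideal)
  show "f \<in> GDN_ideal p" if f: "fin_supp f" "phi_lin f \<in> DS_ideal p"
  proof -
    \<comment> \<open>Modulo the ideal \<open>f\<close> is a combination \<open>g\<close> of
      tableaux. The image of \<open>g\<close> also lies in \<open>DS_ideal\<close>, so independence
      forces \<open>g = 0\<close>.\<close>
    from span[OF f(1)] obtain g where g: "fin_supp g" "{t. g t \<noteq> 0} \<subseteq> Tab p" "f - g \<in> GDN_ideal p"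
      by blast
    have "phi_lin (f - g) = phi_lin f - phi_lin g" using f(1) g(1) by (simp add: phi_lin_def)
    then have "phi_lin g = phi_lin f - phi_lin (f - g)" by simp
    then have "phi_lin g \<in> DS_ideal p"
      using subsp_diff[OF subsp_DS_ideal f(2) phi_ideal[OF g(3)]] by simp
    with g have "g = 0" by (intro Tab_independent)
    then show ?thesis using g(3) by simp
  qed
qed

end
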